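(* Let $X\subset\mathbb P^2$ be a non-singular plane quartic over $\mathbb C$ with a hyper-flex point $\infty\in X$, and let $D$ be an effective divisor of degree $3$ on $X$. Then there exists a conic $A$ satisfying $A\cdot X\ge D+2\infty$, and for such a conic the inverse in $JX$ of the class of $D-3\infty$ is the class of the divisor $A\cdot X-D-5\infty$.
   Context: The ground field is $\mathbb C$. A hyper-flex point is a point $p\in X$ whose tangent line meets $X$ with multiplicity $4$ at $p$. $JX$ is the Jacobian of $X$ (degree-zero divisor classes). $A\cdot X$ denotes the divisor cut out on $X$ by the conic $A$. *)

theory Defs
  imports
    "HOL-Analysis.Cartesian_Space"
    "HOL-Computational_Algebra.Polynomial_Factorial"
    "HOL-Algebra.Coset"
    "HOL-Library.Function_Algebras"
begin

text \<open>
  The ring \<open>\<complex>[x, y, z]\<close> is rendered as nested univariate polynomials, with \<open>x\<close> the outermost and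
  \<open>z\<close> the innermost variable: the coefficient of \<open>x^i y^j z^k\<close> in \<open>F\<close> is
  \<open>coeff (coeff (coeff F i) j) k\<close>.
\<close>

type_synonym poly3 = "complex poly poly poly"

definition eval3 :: "poly3 \<Rightarrow> complex ^ 3 \<Rightarrow> complex" where
  "eval3 F v = poly (poly (poly F [:[:v $ 1:]:]) [:v $ 2:]) (v $ 3)"

definition homogeneous :: "nat \<Rightarrow> poly3 \<Rightarrow> bool" where
  "homogeneous d F \<longleftrightarrow> (\<forall>i j k. coeff (coeff (coeff F i) j) k \<noteq> 0 \<longrightarrow> i + j + k = d)"

definition partial_x :: "poly3 \<Rightarrow> poly3" where
  "partial_x F = pderiv F"

definition partial_y :: "poly3 \<Rightarrow> poly3" where
  "partial_y F = map_poly pderiv F"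

definition partial_z :: "poly3 \<Rightarrow> poly3" where
  "partial_z F = map_poly (map_poly pderiv) F"

text \<open>Points of the projective plane are the lines through the origin of \<open>\<complex>^3\<close>.\<close>

typedef proj_plane = "{L :: (complex ^ 3) set. \<exists>v. v \<noteq> 0 \<and> L = vec.span {v}}"
  morphisms line_of point_of
proof -
  have "(1 :: complex ^ 3) \<noteq> 0" by (simp add: vec_eq_iff)
  then show ?thesis by blast
qed

text \<open>Only meaningful for homogeneous polynomials.\<close>

definition vanishes_at :: "poly3 \<Rightarrow> proj_plane \<Rightarrow> bool" where
  "vanishes_at F p \<longleftrightarrow> (\<forall>v \<in> line_of p. eval3 F v = 0)"

definition curve :: "poly3 \<Rightarrow> proj_plane set" where
  "curve F = {p. vanishes_at F p}"

text \<open>A plane curve is given by its equation; the equation 0 is excluded by nonsingularity.\<close>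

definition nonsingular_plane_quartic :: "poly3 \<Rightarrow> bool" where
  "nonsingular_plane_quartic F \<longleftrightarrow>
     homogeneous 4 F \<and>
     (\<forall>p \<in> curve F. \<not> (vanishes_at (partial_x F) p \<and> vanishes_at (partial_y F) p \<and>
                        vanishes_at (partial_z F) p))"

definition conic :: "poly3 \<Rightarrow> bool" where
  "conic A \<longleftrightarrow> homogeneous 2 A \<and> A \<noteq> 0"

text \<open>
  The local ring of the projective plane at \<open>p\<close>, inside the field of fractions of \<open>\<complex>[x, y, z]\<close>,
  the powers of its maximal ideal, and the ideal of the curve \<open>F = 0\<close> in it. The local ring of the
  curve at \<open>p\<close> is \<open>local_ring p\<close> modulo \<open>curve_ideal F p\<close>.
\<close>

definition local_ring :: "proj_plane \<Rightarrow> poly3 fract set" where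
  "local_ring p = {Fract G H | G H d. homogeneous d G \<and> homogeneous d H \<and> \<not> vanishes_at H p}"

definition maximal_ideal :: "proj_plane \<Rightarrow> poly3 fract set" where
  "maximal_ideal p =
     {Fract G H | G H d. homogeneous d G \<and> homogeneous d H \<and> \<not> vanishes_at H p \<and> vanishes_at G p}"

primrec maximal_ideal_power :: "proj_plane \<Rightarrow> nat \<Rightarrow> poly3 fract set" where
  "maximal_ideal_power p 0 = local_ring p"
| "maximal_ideal_power p (Suc n) =
     {(\<Sum>i<k. a i * b i) | (k :: nat) a b.
        \<forall>i<k. a i \<in> maximal_ideal p \<and> b i \<in> maximal_ideal_power p n}"

definition curve_ideal :: "poly3 \<Rightarrow> proj_plane \<Rightarrow> poly3 fract set" where
  "curve_ideal F p =
     {Fract G H | G H d. homogeneous d G \<and> homogeneous d H \<and> \<not> vanishes_at H p \<and> F dvd G}"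

text \<open>
  \<open>germ_in_power F p n g\<close>: the class of \<open>g\<close> in the local ring of the curve at \<open>p\<close> lies in the
  \<open>n\<close>-th power of the maximal ideal of that ring.
\<close>

definition germ_in_power :: "poly3 \<Rightarrow> proj_plane \<Rightarrow> nat \<Rightarrow> poly3 fract \<Rightarrow> bool" where
  "germ_in_power F p n g \<longleftrightarrow>
     (\<exists>u \<in> maximal_ideal_power p n. \<exists>w \<in> curve_ideal F p. g = u + w)"

text \<open>
  Multiplicity at the point \<open>p\<close> of the divisor cut out by the form \<open>G\<close> on the curve \<open>F = 0\<close>: the
  order of the local equation \<open>G / H\<close>, where \<open>H\<close> is any form of the same degree not vanishing at
  \<open>p\<close>; another choice of \<open>H\<close> changes the local equation by a unit.
  It is used for \<open>F\<close> nonsingular, where the local ring of the curve is a discrete valuation ring,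
  and for \<open>F\<close> not dividing \<open>G\<close> (otherwise the order would be infinite, and the value is arbitrary).
\<close>

definition intersection_mult :: "poly3 \<Rightarrow> proj_plane \<Rightarrow> poly3 \<Rightarrow> nat" where
  "intersection_mult F p G =
     (GREATEST n. \<exists>H d. homogeneous d G \<and> homogeneous d H \<and> \<not> vanishes_at H p \<and>
                        germ_in_power F p n (Fract G H))"

definition tangent_form :: "poly3 \<Rightarrow> complex ^ 3 \<Rightarrow> poly3" where
  "tangent_form F v =
     (let a = eval3 (partial_x F) v; b = eval3 (partial_y F) v; c = eval3 (partial_z F) v
      in [:[:[:0, c:], [:b:]:], [:[:a:]:]:])" \<comment> \<open>\<open>a x + b y + c z\<close>\<close>

definition hyperflex :: "poly3 \<Rightarrow> proj_plane \<Rightarrow> bool" where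
  "hyperflex F p \<longleftrightarrow>
     p \<in> curve F \<and>
     (\<exists>v \<in> line_of p. v \<noteq> 0 \<and> intersection_mult F p (tangent_form F v) = 4)"

text \<open>
  Divisors are integer-valued functions on the plane with finite support contained in the curve;
  their sum and order are the pointwise ones.
\<close>

type_synonym divisor = "proj_plane \<Rightarrow> int"

definition divisors :: "poly3 \<Rightarrow> divisor set" where
  "divisors F = {D. finite {p. D p \<noteq> 0} \<and> {p. D p \<noteq> 0} \<subseteq> curve F}"

definition divisor_degree :: "divisor \<Rightarrow> int" where
  "divisor_degree D = (\<Sum>p | D p \<noteq> 0. D p)"

definition point_multiple :: "int \<Rightarrow> proj_plane \<Rightarrow> divisor" where
  "point_multiple n p = (\<lambda>q. if q = p then n else 0)"

definition cut_divisor :: "poly3 \<Rightarrow> poly3 \<Rightarrow> divisor" where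
  "cut_divisor F G = (\<lambda>p. if p \<in> curve F then int (intersection_mult F p G) else 0)"

text \<open>
  Nonzero rational functions on the curve are the restrictions of quotients \<open>G / H\<close> of forms of
  equal degree that do not vanish identically on the curve (a nonsingular plane curve is
  irreducible).
\<close>

definition principal_divisors :: "poly3 \<Rightarrow> divisor set" where
  "principal_divisors F =
     {cut_divisor F G - cut_divisor F H | G H d.
        homogeneous d G \<and> homogeneous d H \<and> \<not> F dvd G \<and> \<not> F dvd H}"

definition divisor_group :: "poly3 \<Rightarrow> divisor monoid" where
  "divisor_group F = \<lparr>carrier = divisors F, mult = (+), one = 0\<rparr>"

definition class_group :: "poly3 \<Rightarrow> divisor set monoid" where
  "class_group F = divisor_group F Mod principal_divisors F"

definition divisor_class :: "poly3 \<Rightarrow> divisor \<Rightarrow> divisor set" where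
  "divisor_class F D = principal_divisors F #>\<^bsub>divisor_group F\<^esub> D"

definition jacobian :: "poly3 \<Rightarrow> divisor set monoid" where
  "jacobian F =
     (class_group F)\<lparr>carrier := {divisor_class F D | D. D \<in> divisors F \<and> divisor_degree D = 0}\<rparr>"

end

(*
  The tangent at the hyper-flex cuts out 4 P and its square 8 P, so A.X - 8 P is the divisor of a
  rational function for every conic A, and A.X - D - 5 P is equivalent to -(D - 3 P). The conic
  exists because conics have 6 coefficients and contact D + 2 P imposes 5 linear conditions.

  Multiplicities are read off from a formal parametrisation of the curve at each point: the
  local ring modulo the curve embeds in the power series ring, and the order of a form is that of
  its pull-back. The orders are finite and additive because a form vanishing on one branch is a
  multiple of F, which needs the irreducibility of F: two forms of degrees 1 + 3 or 2 + 2 have a common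
  zero (parametrise the conic from one of its points), where their product would be singular.
  That the tangent at P meets the curve nowhere else is seen by exchanging the roles of F and the
  tangent: F restricted to the tangent has a fourfold zero at P, hence no other one.
*)
theory Submission
  imports
    Defs
    "HOL-Computational_Algebra.Field_as_Ring"
    "HOL-Computational_Algebra.Formal_Laurent_Series"
    "HOL-Computational_Algebra.Fundamental_Theorem_Algebra"
    "HOL-Computational_Algebra.Polynomial_FPS"
begin


(* The symbol $ is reserved for vector components here. *)
no_notation fps_nth (infixl \<open>$\<close> 75)

section \<open>Evaluation of ternary polynomials\<close>

text \<open>The multiplicity is a \<open>GREATEST\<close> over powers of an ideal in a local ring of
  fractions, and nothing bounds it a priori. A branch with coordinates \<open>1\<close>,
  \<open>c + X\<close> and a series supplied by Hensel's lemma turns it into a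
  \<open>subdegree\<close>. One inequality is formal: pulling back sends the maximal ideal into the
  multiples of \<open>X\<close> and the ideal of the curve to 0. The other divides by the local
  parameter as often as the pull-back is divisible by \<open>X\<close>. The bound comes from the
  fact that a branch is not a constant point. If \<open>F\<close> does not divide the form
  \<open>G\<close>, elimination of one variable leaves polynomials with complex coefficients, whose
  roots in any extension field are complex; so all common zeros, even over Laurent series, are
  proportional to complex points, while \<open>1\<close> and \<open>c + X\<close> have a
  non-constant ratio. Irreducibility of \<open>F\<close> drives the elimination, smoothness drives
  Hensel's lemma.\<close>

definition ring_map :: "('a::comm_ring_1 \<Rightarrow> 'b::comm_ring_1) \<Rightarrow> bool" where
  "ring_map h \<longleftrightarrow> h 1 = 1 \<and> (\<forall>x y. h (x + y) = h x + h y) \<and> (\<forall>x y. h (x * y) = h x * h y)"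

lemma ring_map_add: "ring_map h \<Longrightarrow> h (x + y) = h x + h y"
  and ring_map_mult: "ring_map h \<Longrightarrow> h (x * y) = h x * h y"
  and ring_map_1: "ring_map h \<Longrightarrow> h 1 = 1"
  by (auto simp: ring_map_def)

lemma ring_map_0: "ring_map h \<Longrightarrow> h 0 = 0"
  using ring_map_add[of h 0 0] by simp

lemma ring_map_uminus: "ring_map h \<Longrightarrow> h (- x) = - h x"
  using ring_map_add[of h x "- x"] by (simp add: ring_map_0 eq_neg_iff_add_eq_0 add.commute)

lemma ring_map_diff: "ring_map h \<Longrightarrow> h (x - y) = h x - h y"
  using ring_map_add[of h x "- y"] by (simp add: ring_map_uminus)

lemma ring_map_power: "ring_map h \<Longrightarrow> h (x ^ n) = h x ^ n"
  by (induction n) (auto simp: ring_map_1 ring_map_mult)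

lemma ring_map_sum: "ring_map h \<Longrightarrow> h (sum f A) = (\<Sum>x\<in>A. h (f x))"
  by (induction A rule: infinite_finite_induct) (auto simp: ring_map_0 ring_map_add)

lemma ring_map_compose: "ring_map g \<Longrightarrow> ring_map h \<Longrightarrow> ring_map (\<lambda>x. g (h x))"
  by (auto simp: ring_map_def)

lemma ring_map_poly:
  assumes "ring_map h"
  shows "ring_map (\<lambda>p. poly (map_poly h p) b)"
proof -
  have h0: "h 0 = 0" by (rule ring_map_0) fact
  have add: "poly (map_poly h (p + q)) b = poly (map_poly h p) b + poly (map_poly h q) b" for p q
    by (induction p q rule: poly_induct2)
      (auto simp: map_poly_pCons h0 ring_map_add[OF assms] algebra_simps)
  have smult: "poly (map_poly h (smult c p)) b = h c * poly (map_poly h p) b" for c p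
    by (induction p) (auto simp: map_poly_pCons h0 ring_map_mult[OF assms] algebra_simps)
  have mult: "poly (map_poly h (p * q)) b = poly (map_poly h p) b * poly (map_poly h q) b" for p q
    by (induction p) (auto simp: map_poly_pCons h0 add smult algebra_simps)
  show ?thesis
    using add mult by (simp add: ring_map_def ring_map_1[OF assms] h0)
qed

text \<open>A single evaluation with values in any ring serves points (complex numbers),
  restrictions to lines (polynomials), branches (power series), their generic points (Laurent
  series), the grading and the equation fed to Hensel's lemma.\<close>

definition ev :: "(complex \<Rightarrow> 'r::comm_ring_1) \<Rightarrow> poly3 \<Rightarrow> 'r ^ 3 \<Rightarrow> 'r" where
  "ev h F a = poly (map_poly (\<lambda>q. poly (map_poly (\<lambda>r. poly (map_poly h r) (a $ 3)) q) (a $ 2)) F) (a $ 1)"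

lemma ring_map_ev: "ring_map h \<Longrightarrow> ring_map (\<lambda>F. ev h F a)"
  unfolding ev_def by (intro ring_map_poly)

lemmas ev_add = ring_map_add[OF ring_map_ev]
  and ev_mult = ring_map_mult[OF ring_map_ev]
  and ev_0 = ring_map_0[OF ring_map_ev]
  and ev_1 = ring_map_1[OF ring_map_ev]
  and ev_diff = ring_map_diff[OF ring_map_ev]
  and ev_uminus = ring_map_uminus[OF ring_map_ev]
  and ev_power = ring_map_power[OF ring_map_ev]
  and ev_sum = ring_map_sum[OF ring_map_ev]

definition monom3 :: "complex \<Rightarrow> nat \<Rightarrow> nat \<Rightarrow> nat \<Rightarrow> poly3" where
  "monom3 c i j k = monom (monom (monom c k) j) i"

lemma ev_monom3:
  assumes "ring_map h"
  shows "ev h (monom3 c i j k) a = h c * a $ 1 ^ i * a $ 2 ^ j * a $ 3 ^ k"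
proof -
  have *: "ring_map (\<lambda>r. poly (map_poly h r) (a $ 3))"
    "ring_map (\<lambda>q. poly (map_poly (\<lambda>r. poly (map_poly h r) (a $ 3)) q) (a $ 2))"
    by (intro ring_map_poly assms)+
  show ?thesis
    by (simp add: ev_def monom3_def map_poly_monom ring_map_0[OF assms] ring_map_0[OF *(1)]
        ring_map_0[OF *(2)] poly_monom algebra_simps)
qed

lemma coeff_monom3:
  "coeff (coeff (coeff (monom3 c i j k) i') j') k' = (if i = i' \<and> j = j' \<and> k = k' then c else 0)"
  by (auto simp: monom3_def)

lemma poly3_eq_iff: "F = G \<longleftrightarrow> (\<forall>i j k. coeff (coeff (coeff F i) j) k = coeff (coeff (coeff G i) j) k)"
  by (auto simp: poly_eq_iff)

lemma poly3_eq_sum_monom3: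
  "F = (\<Sum>i\<le>degree F. \<Sum>j\<le>degree (coeff F i). \<Sum>k\<le>degree (coeff (coeff F i) j).
          monom3 (coeff (coeff (coeff F i) j) k) i j k)" (is "_ = ?S")
proof -
  have 1: "(\<Sum>k\<le>degree r. monom3 (coeff r k) i j k) = monom (monom r j) i" for r i j
  proof -
    have "(\<Sum>k\<le>degree r. monom3 (coeff r k) i j k) = monom (monom (\<Sum>k\<le>degree r. monom (coeff r k) k) j) i"
      unfolding monom3_def by (simp add: monom_sum)
    then show ?thesis by (simp add: poly_as_sum_of_monoms)
  qed
  have 2: "(\<Sum>j\<le>degree q. monom (monom (coeff q j) j) i) = monom q i" for q :: "complex poly poly" and i
  proof -
    have "(\<Sum>j\<le>degree q. monom (monom (coeff q j) j) i) = monom (\<Sum>j\<le>degree q. monom (coeff q j) j) i"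
      by (simp add: monom_sum)
    then show ?thesis by (simp add: poly_as_sum_of_monoms)
  qed
  show ?thesis unfolding 1 2 by (simp add: poly_as_sum_of_monoms)
qed

text \<open>The monomials of other degrees have coefficient 0, so they fall under the case
  \<open>P 0\<close>. The case of a sum does not know that its summands are forms; a predicate that
  needs this has to contain it.\<close>

lemma form_induct [consumes 1, case_names zero add monom3]:
  assumes "homogeneous n F"
    and "P 0" and add: "\<And>G H. P G \<Longrightarrow> P H \<Longrightarrow> P (G + H)"
    and monom3: "\<And>c i j k. i + j + k = n \<Longrightarrow> P (monom3 c i j k)"
  shows "P F"
proof -
  have sum: "P (sum f A)" if "\<And>x. x \<in> A \<Longrightarrow> P (f x)" for f :: "nat \<Rightarrow> poly3" and A
    using that by (induction A rule: infinite_finite_induct) (auto intro: \<open>P 0\<close> add)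
  have "P (monom3 (coeff (coeff (coeff F i) j) k) i j k)" for i j k
  proof (cases "coeff (coeff (coeff F i) j) k = 0")
    case True
    then show ?thesis using \<open>P 0\<close> by (simp add: monom3_def)
  next
    case False
    then show ?thesis using assms(1) monom3 by (auto simp: homogeneous_def)
  qed
  then show ?thesis by (subst poly3_eq_sum_monom3) (intro sum)
qed

lemma poly3_induct [case_names zero add monom3]:
  assumes "P 0" and add: "\<And>G H. P G \<Longrightarrow> P H \<Longrightarrow> P (G + H)"
    and monom3: "\<And>c i j k. P (monom3 c i j k)"
  shows "P F"
proof -
  have sum: "P (sum f A)" if "\<And>x. x \<in> A \<Longrightarrow> P (f x)" for f :: "nat \<Rightarrow> poly3" and A
    using that by (induction A rule: infinite_finite_induct) (auto intro: \<open>P 0\<close> add)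
  show ?thesis by (subst poly3_eq_sum_monom3) (intro sum monom3)
qed

lemma ring_map_id: "ring_map (\<lambda>x. x)" by (simp add: ring_map_def)
lemma ring_map_pCons: "ring_map (\<lambda>c. [:c:])" by (simp add: ring_map_def)
lemma ring_map_fps_const: "ring_map fps_const" by (simp add: ring_map_def)
lemma ring_map_poly_at: "ring_map (\<lambda>p. poly p x)" by (simp add: ring_map_def)
lemma ring_map_fps_nth_0: "ring_map (\<lambda>f. fps_nth f 0)" by (simp add: ring_map_def)

lemma ev_compose:
  assumes "ring_map g" "ring_map h"
  shows "g (ev h F a) = ev (\<lambda>c. g (h c)) F (\<chi> i. g (a $ i))"
proof (induction F rule: poly3_induct)
  case (monom3 c i j k)
  show ?case
    by (simp add: ev_monom3 assms ring_map_compose ring_map_mult[OF assms(1)] ring_map_power[OF assms(1)])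
qed (simp_all add: ring_map_0 ring_map_add ev_0 ev_add ring_map_compose assms)

lemma eval3_eq_ev: "eval3 F v = ev (\<lambda>x. x) F v"
proof (induction F rule: poly3_induct)
  case (monom3 c i j k)
  have "eval3 (monom3 c i j k) v = c * v $ 1 ^ i * v $ 2 ^ j * v $ 3 ^ k"
    by (simp add: eval3_def monom3_def poly_monom poly_power algebra_simps)
  then show ?case by (simp add: ev_monom3 ring_map_id)
qed (auto simp: ev_0 ev_add ring_map_id eval3_def)

lemma partial_add:
  "partial_x (G + H) = partial_x G + partial_x H"
  "partial_y (G + H) = partial_y G + partial_y H"
  "partial_z (G + H) = partial_z G + partial_z H"
  by (auto simp: partial_x_def partial_y_def partial_z_def pderiv_add poly_eq_iff coeff_map_poly
      simp del: coeff_pderiv)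

lemma partial_0 [simp]: "partial_x 0 = 0" "partial_y 0 = 0" "partial_z 0 = 0"
  by (auto simp: partial_x_def partial_y_def partial_z_def)

lemma partial_monom3:
  "partial_x (monom3 c i j k) = monom3 (of_nat i * c) (i - 1) j k"
  "partial_y (monom3 c i j k) = monom3 (of_nat j * c) i (j - 1) k"
  "partial_z (monom3 c i j k) = monom3 (of_nat k * c) i j (k - 1)"
  by (simp_all add: partial_x_def partial_y_def partial_z_def monom3_def pderiv_monom map_poly_monom
      of_nat_poly smult_monom)

definition partial :: "3 \<Rightarrow> poly3 \<Rightarrow> poly3" where
  "partial i = (if i = 1 then partial_x else if i = 2 then partial_y else partial_z)"

text \<open>The chain rule, checked on monomials. It yields directional derivatives on lines and the
  derivative required by Hensel's lemma.\<close>

lemma pderiv_ev: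
  assumes h: "ring_map h" "\<And>c. pderiv (h c) = 0"
  shows "pderiv (ev h F a) = (\<Sum>i\<in>UNIV. ev h (partial i F) a * pderiv (a $ i))"
proof (induction F rule: poly3_induct)
  case (monom3 c i j k)
  have of_nat: "h (of_nat n) = of_nat n" for n
    by (induction n) (simp_all add: ring_map_0[OF h(1)] ring_map_1[OF h(1)] ring_map_add[OF h(1)])
  have pow: "pderiv (p ^ n) = of_nat n * p ^ (n - 1) * pderiv p" for p :: "'a poly" and n
    by (cases n) (simp_all add: pderiv_power_Suc of_nat_poly del: of_nat_Suc power_Suc)
  show ?case
    by (simp add: sum_3 partial_def partial_monom3 ev_monom3[OF h(1)] pderiv_mult pow h(2)
        ring_map_mult[OF h(1)] of_nat algebra_simps)
qed (simp_all add: sum_3 partial_def partial_add ev_0 ev_add h(1) pderiv_add algebra_simps)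

lemma homogeneous_monom3: "i + j + k = n \<Longrightarrow> homogeneous n (monom3 c i j k)"
  by (auto simp: homogeneous_def coeff_monom3 split: if_splits)

lemma homogeneous_add: "homogeneous n G \<Longrightarrow> homogeneous n H \<Longrightarrow> homogeneous n (G + H)"
  by (auto simp: homogeneous_def) (metis add.right_neutral)

lemma homogeneous_0 [simp]: "homogeneous n 0"
  by (simp add: homogeneous_def)

lemma homogeneous_sum: "(\<And>x. x \<in> S \<Longrightarrow> homogeneous n (f x)) \<Longrightarrow> homogeneous n (sum f S)"
  by (induction S rule: infinite_finite_induct) (auto intro: homogeneous_add)

lemma homogeneous_partial:
  assumes "homogeneous (Suc n) F" shows "homogeneous n (partial l F)"
  using assms
proof (induction rule: form_induct)
  case (monom3 c i j k)
  have "homogeneous n (monom3 (of_nat i * c) (i - 1) j k)"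
    using monom3 by (cases i) (auto simp: monom3_def[of 0] intro: homogeneous_monom3)
  moreover have "homogeneous n (monom3 (of_nat j * c) i (j - 1) k)"
    using monom3 by (cases j) (auto simp: monom3_def[of 0] intro: homogeneous_monom3)
  moreover have "homogeneous n (monom3 (of_nat k * c) i j (k - 1))"
    using monom3 by (cases k) (auto simp: monom3_def[of 0] intro: homogeneous_monom3)
  ultimately show ?case by (simp add: partial_def partial_monom3)
qed (auto simp: partial_def partial_add intro: homogeneous_add)

lemma ev_scale:
  assumes "homogeneous n F" "ring_map h"
  shows "ev h F (\<chi> i. r * a $ i) = r ^ n * ev h F a"
  using assms(1)
proof (induction rule: form_induct)
  case (monom3 c i j k)
  then show ?case
    by (auto simp: ev_monom3[OF assms(2)] power_mult_distrib power_add)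
qed (simp_all add: ev_0 ev_add assms algebra_simps)

text \<open>The coefficient is taken at the degree bound instead of the actual degree, so it may be
  0; for binary forms this is the value at infinity.\<close>

lemma coeff_power_bound:
  fixes p :: "'a::comm_ring_1 poly"
  assumes "degree p \<le> m"
  shows "degree (p ^ n) \<le> n * m \<and> coeff (p ^ n) (n * m) = coeff p m ^ n"
proof (induction n)
  case (Suc n)
  have "degree (p * p ^ n) \<le> m + n * m"
    using degree_mult_le[of p "p ^ n"] Suc assms by linarith
  moreover have "coeff (p * p ^ n) (m + n * m) = coeff p m * coeff (p ^ n) (n * m)"
  proof (cases "degree p = m \<and> degree (p ^ n) = n * m")
    case True
    then show ?thesis using coeff_mult_degree_sum[of p "p ^ n"] by simp
  next
    case False
    then have lt: "degree p < m \<or> degree (p ^ n) < n * m" using assms Suc by auto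
    then have "coeff p m * coeff (p ^ n) (n * m) = 0" by (auto simp: coeff_eq_0)
    moreover have "degree (p * p ^ n) < m + n * m"
      using degree_mult_le[of p "p ^ n"] lt assms Suc by linarith
    ultimately show ?thesis by (simp add: coeff_eq_0)
  qed
  ultimately show ?case using Suc by simp
qed simp

lemma coeff_mult_bound:
  fixes p q :: "'a::comm_ring_1 poly"
  assumes "degree p \<le> m" "degree q \<le> n"
  shows "degree (p * q) \<le> m + n \<and> coeff (p * q) (m + n) = coeff p m * coeff q n"
proof (cases "degree p = m \<and> degree q = n")
  case True
  then show ?thesis using coeff_mult_degree_sum[of p q] degree_mult_le[of p q] by simp
next
  case False
  then have lt: "degree p < m \<or> degree q < n" using assms by auto
  then have "coeff p m * coeff q n = 0" by (auto simp: coeff_eq_0)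
  moreover have "degree (p * q) < m + n"
    using degree_mult_le[of p q] lt assms by linarith
  ultimately show ?thesis by (simp add: coeff_eq_0)
qed

text \<open>A polynomial curve of degree \<open>m\<close> has the vector of its coefficients at
  \<open>m\<close> as its point at infinity. A drop of the degree below \<open>n * m\<close>
  therefore means that \<open>F\<close> vanishes there.\<close>

lemma ev_poly_top_coeff:
  assumes "homogeneous n F" and deg: "\<And>i. degree (a $ i) \<le> m"
  shows "degree (ev (\<lambda>c. [:c:]) F a) \<le> n * m \<and>
    coeff (ev (\<lambda>c. [:c:]) F a) (n * m) = eval3 F (\<chi> i. coeff (a $ i) m)"
  using assms(1)
proof (induction rule: form_induct)
  case (monom3 c i j k)
  note pow = coeff_power_bound[OF deg]
  note 2 = coeff_mult_bound[OF pow[THEN conjunct1] pow[THEN conjunct1], of 1 i 2 j]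
  note 3 = coeff_mult_bound[OF 2[THEN conjunct1] pow[THEN conjunct1], of 3 k]
  have "n * m = i * m + j * m + k * m" unfolding monom3[symmetric] by (simp add: algebra_simps)
  then show ?case
    using 3 by (simp add: 2 pow ev_monom3 ring_map_pCons ring_map_id eval3_eq_ev mult.assoc)
qed (auto simp: ev_0 ev_add ring_map_pCons ring_map_id eval3_eq_ev intro: degree_add_le)

section \<open>Homogeneity\<close>

lemma monom3_mult: "monom3 c i j k * monom3 c' i' j' k' = monom3 (c * c') (i + i') (j + j') (k + k')"
  by (simp add: monom3_def mult_monom)

lemma monom3_power: "monom3 c i j k ^ n = monom3 (c ^ n) (n * i) (n * j) (n * k)"
proof (induction n)
  case 0
  show ?case by (simp add: monom3_def monom_0 one_pCons)
qed (simp add: monom3_mult)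

definition coord :: "3 \<Rightarrow> poly3" where
  "coord l = monom3 1 (if l = 1 then 1 else 0) (if l = 2 then 1 else 0) (if l = 3 then 1 else 0)"

text \<open>This is \<open>F(Tx, Ty, Tz)\<close> in a new variable \<open>T\<close>: the coefficient
  of \<open>T^n\<close> is the part of degree \<open>n\<close>. Being a ring homomorphism, it turns
  homogeneity into being a monomial in \<open>T\<close>.\<close>

definition grade :: "poly3 \<Rightarrow> poly3 poly" where
  "grade F = ev (\<lambda>c. [:[:[:[:c:]:]:]:]) F
     (\<chi> i. monom (coord i) 1)"

lemma ring_map_grade: "ring_map grade"
  unfolding grade_def by (rule ring_map_ev) (simp add: ring_map_def one_pCons)

lemma grade_monom3: "grade (monom3 c i j k) = monom (monom3 c i j k) (i + j + k)"
proof -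
  have *: "[:[:[:[:c:]:]:]:] = monom (monom3 c 0 0 0) 0" by (simp add: monom3_def monom_0)
  have **: "ring_map (\<lambda>c::complex. [:[:[:[:c:]:]:]:])" by (simp add: ring_map_def one_pCons)
  show ?thesis
    unfolding grade_def ev_monom3[OF **] * by (simp add: coord_def monom_power mult_monom monom3_power monom3_mult)
qed

lemma coeff_grade:
  "coeff (coeff (coeff (coeff (grade F) n) i) j) k =
     (if i + j + k = n then coeff (coeff (coeff F i) j) k else 0)"
proof (induction F rule: poly3_induct)
  case zero
  show ?case by (simp add: ring_map_0[OF ring_map_grade])
next
  case (add G H)
  then show ?case by (simp add: ring_map_add[OF ring_map_grade])
next
  case (monom3 c i' j' k')
  show ?case by (simp add: grade_monom3 coeff_monom3)
qed

lemma homogeneous_iff_grade: "homogeneous n F \<longleftrightarrow> (\<forall>m. m \<noteq> n \<longrightarrow> coeff (grade F) m = 0)"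
  unfolding homogeneous_def poly3_eq_iff coeff_grade by auto

lemma homogeneous_iff_grade_monom: "homogeneous n F \<longleftrightarrow> grade F = monom F n"
proof
  assume *: "homogeneous n F"
  have "coeff (grade F) m = coeff (monom F n) m" for m
  proof (cases "m = n")
    case True
    then show ?thesis
      using * by (auto simp: poly3_eq_iff coeff_grade homogeneous_def)
  next
    case False
    then show ?thesis using * by (simp add: homogeneous_iff_grade)
  qed
  then show "grade F = monom F n" by (simp add: poly_eq_iff)
qed (simp add: homogeneous_iff_grade)

lemma homogeneous_mult:
  assumes "homogeneous m F" "homogeneous n G"
  shows "homogeneous (m + n) (F * G)"
  using assms by (simp add: homogeneous_iff_grade_monom ring_map_mult[OF ring_map_grade] mult_monom)

lemma homogeneous_1: "homogeneous 0 1"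
  by (simp add: homogeneous_iff_grade_monom ring_map_1[OF ring_map_grade])

lemma homogeneous_power: "homogeneous m F \<Longrightarrow> homogeneous (n * m) (F ^ n)"
  by (induction n) (auto intro: homogeneous_1 homogeneous_mult)

text \<open>Order at 0 and degree are both additive, the order is at most the degree, and the two
  agree on the product; hence they agree on each factor.\<close>

lemma monom_factor:
  fixes p q :: "'a::idom poly"
  assumes "p * q = monom c n" "c \<noteq> 0"
  shows "\<exists>u a. p = monom u a"
proof -
  have nz: "p * q \<noteq> 0" "p \<noteq> 0" "q \<noteq> 0" using assms by auto
  have "Polynomial.order 0 p + Polynomial.order 0 q = n"
    using order_mult[OF nz(1), of 0] assms by (simp add: order_0_monom)
  moreover have "degree p + degree q = n"
    using degree_mult_eq[OF nz(2,3)] assms by (simp add: degree_monom_eq)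
  ultimately have "degree p \<le> Polynomial.order 0 p"
    using order_degree[OF nz(2), of 0] order_degree[OF nz(3), of 0] by simp
  then have "monom 1 (degree p) dvd p" using nz by (simp add: monom_1_dvd_iff)
  then have "coeff p m = 0" if "m \<noteq> degree p" for m
    using that by (cases "m < degree p") (auto simp: monom_1_dvd_iff' coeff_eq_0)
  then have "p = monom (lead_coeff p) (degree p)" by (auto simp: poly_eq_iff)
  then show ?thesis by blast
qed

lemma homogeneous_unique:
  assumes "homogeneous m F" "homogeneous n F" "F \<noteq> 0"
  shows "m = n"
proof -
  obtain i j k where "coeff (coeff (coeff F i) j) k \<noteq> 0"
    using assms(3) by (auto simp: poly3_eq_iff)
  then show ?thesis using assms(1,2) by (auto simp: homogeneous_def)
qed

text \<open>Under \<open>grade\<close> the factors become factors of a monomial in \<open>T\<close>,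
  hence monomials themselves.\<close>

lemma homogeneous_factors:
  assumes "homogeneous n (G * H)" "G * H \<noteq> 0"
  obtains a b where "homogeneous a G" "homogeneous b H" "a + b = n"
proof -
  have *: "grade G * grade H = monom (G * H) n"
    using assms by (simp add: homogeneous_iff_grade_monom ring_map_mult[OF ring_map_grade])
  obtain u a where "grade G = monom u a" using monom_factor[OF * assms(2)] by blast
  then have G: "homogeneous a G" by (auto simp: homogeneous_iff_grade)
  obtain v b where "grade H = monom v b"
    using monom_factor[OF _ assms(2), of "grade H" "grade G" n] * by (auto simp: mult.commute)
  then have H: "homogeneous b H" by (auto simp: homogeneous_iff_grade)
  have "a + b = n" by (rule homogeneous_unique[OF homogeneous_mult[OF G H] assms])
  with G H show ?thesis by (rule that)
qed

text \<open>A cofactor would be a form as well, and the degrees would add up. Every non-divisibility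
  of a line or a conic by the quartic comes from here.\<close>

lemma not_dvd_lower_degree:
  assumes "homogeneous n F" "homogeneous d G" "G \<noteq> 0" "d < n"
  shows "\<not> F dvd G"
proof
  assume "F dvd G"
  then obtain K where K: "G = F * K" by auto
  then obtain a b where "homogeneous a F" "a + b = d"
    using homogeneous_factors[of d F K] assms(2,3) by metis
  moreover have "F \<noteq> 0" using K assms(3) by auto
  ultimately show False using homogeneous_unique[OF assms(1)] assms(4) by fastforce
qed

lemma homogeneous_0_unit:
  assumes "homogeneous 0 F" "F \<noteq> 0"
  shows "F dvd 1"
proof -
  have "F = monom3 (coeff (coeff (coeff F 0) 0) 0) 0 0 0"
    using assms(1) by (auto simp: poly3_eq_iff homogeneous_def coeff_monom3)
  then obtain c where c: "F = monom3 c 0 0 0" by blast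
  moreover have "c \<noteq> 0" using c assms(2) by (auto simp: monom3_def)
  then have "F * monom3 (inverse c) 0 0 0 = 1"
    unfolding c by (simp add: monom3_mult) (simp add: monom3_def monom_0 one_pCons)
  then show ?thesis by (metis dvd_triv_left)
qed

section \<open>Points of the plane and restriction of forms to lines\<close>

lemma eval3_scale: "homogeneous n F \<Longrightarrow> eval3 F (r *s v) = r ^ n * eval3 F v"
  using ev_scale[of n F "\<lambda>x. x" r v] by (simp add: eval3_eq_ev ring_map_id vector_scalar_mult_def)

lemma line_of_point: obtains v where "v \<noteq> 0" "v \<in> line_of p"
proof -
  obtain v where "v \<noteq> 0" "line_of p = vec.span {v}" using line_of[of p] by auto
  then show ?thesis using that vec.span_base by blast
qed

lemma line_of_eq:
  assumes "v \<noteq> 0" "v \<in> line_of p"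
  shows "line_of p = range (\<lambda>t. t *s v)"
proof -
  obtain w where w: "w \<noteq> 0" "line_of p = range (\<lambda>t. t *s w)"
    using line_of[of p] by (auto simp: vec.span_singleton)
  then obtain t where t: "v = t *s w" using assms by auto
  then have "t \<noteq> 0" using assms(1) by auto
  then have "s *s w = (s / t) *s v" for s by (simp add: t)
  then have "s *s w \<in> range (\<lambda>t. t *s v)" for s by blast
  then show ?thesis unfolding w(2) using t by auto
qed

lemma vanishes_at_iff:
  assumes "homogeneous n F" "v \<noteq> 0" "v \<in> line_of p"
  shows "vanishes_at F p \<longleftrightarrow> eval3 F v = 0"
  using assms(3) by (auto simp: vanishes_at_def line_of_eq[OF assms(2,3)] eval3_scale[OF assms(1)])

lemma point_exists: assumes "v \<noteq> 0" obtains p where "v \<in> line_of p"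
proof -
  have "line_of (point_of (vec.span {v})) = vec.span {v}"
    by (rule point_of_inverse) (use assms in auto)
  then show ?thesis using that vec.span_base[of v "{v}"] by auto
qed

lemma nonsingular_homogeneous: "nonsingular_plane_quartic F \<Longrightarrow> homogeneous 4 F"
  by (simp add: nonsingular_plane_quartic_def)

lemma nonsingular_gradient:
  assumes "nonsingular_plane_quartic F" "v \<noteq> 0" "eval3 F v = 0"
  obtains i where "eval3 (partial i F) v \<noteq> 0"
proof -
  obtain p where p: "v \<in> line_of p" using point_exists[OF assms(2)] .
  have hom: "homogeneous 4 F" using assms(1) by (rule nonsingular_homogeneous)
  then have hom': "homogeneous 3 (partial i F)" for i
    using homogeneous_partial[of 3 F] by simp
  have "p \<in> curve F" using assms p hom by (simp add: curve_def vanishes_at_iff)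
  then have "\<not> (vanishes_at (partial 1 F) p \<and> vanishes_at (partial 2 F) p \<and> vanishes_at (partial 3 F) p)"
    using assms(1) by (auto simp: nonsingular_plane_quartic_def partial_def)
  then show ?thesis using that by (auto simp: vanishes_at_iff[OF hom' assms(2) p])
qed

text \<open>The line is affine, but for a form of degree \<open>n\<close> nothing is lost:
  coefficient 0 is the value at \<open>v\<close>, coefficient 1 the derivative at \<open>v\<close>
  in direction \<open>w\<close>, and coefficient \<open>n\<close> the value at the missing point
  \<open>w\<close>.\<close>

definition line_poly :: "poly3 \<Rightarrow> complex ^ 3 \<Rightarrow> complex ^ 3 \<Rightarrow> complex poly" where
  "line_poly F v w = ev (\<lambda>c. [:c:]) F (\<chi> i. [:v $ i, w $ i:])"

lemma poly_ev: "poly (ev (\<lambda>c. [:c:]) F a) t = eval3 F (\<chi> i. poly (a $ i) t)"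
  using ev_compose[OF ring_map_poly_at[of t] ring_map_pCons, of F a] by (simp add: eval3_eq_ev)

lemma poly_line_poly: "poly (line_poly F v w) t = eval3 F (v + t *s w)"
  by (simp add: line_poly_def poly_ev plus_vec_def vector_scalar_mult_def)

lemma degree_line_poly:
  assumes "homogeneous n F"
  shows "degree (line_poly F v w) \<le> n" "coeff (line_poly F v w) n = eval3 F w"
  using ev_poly_top_coeff[OF assms, of "\<chi> i. [:v $ i, w $ i:]" 1]
  by (auto simp: line_poly_def degree_pCons_eq_if)

lemma coeff_line_poly_0: "coeff (line_poly F v w) 0 = eval3 F v"
  using poly_line_poly[of F v w 0] by (simp add: poly_0_coeff_0)

lemma poly_pderiv_line_poly:
  "poly (pderiv (line_poly F v w)) t = (\<Sum>i\<in>UNIV. eval3 (partial i F) (v + t *s w) * w $ i)"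
proof -
  have "pderiv (line_poly F v w) = (\<Sum>i\<in>UNIV. line_poly (partial i F) v w * [:w $ i:])"
    unfolding line_poly_def by (subst pderiv_ev) (simp_all add: ring_map_pCons pderiv_pCons)
  then show ?thesis by (simp add: poly_sum poly_line_poly mult.commute)
qed

lemma coeff_line_poly_1: "coeff (line_poly F v w) 1 = (\<Sum>i\<in>UNIV. eval3 (partial i F) v * w $ i)"
  using poly_pderiv_line_poly[of F v w 0] by (simp add: poly_0_coeff_0 coeff_pderiv)

section \<open>Lines, conics and irreducibility\<close>

lemma complex_poly_root:
  fixes p :: "complex poly"
  assumes "degree p > 0"
  obtains t where "poly p t = 0"
  using fundamental_theorem_of_algebra[of p] constant_degree[of p] assms by auto

text \<open>Either the point at infinity \<open>w\<close> is a zero, or the restriction has full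
  degree \<open>n > 0\<close> and a complex root.\<close>

lemma zero_on_line:
  assumes hom: "homogeneous n F" and "n > 0"
  obtains \<alpha> \<beta> where "\<alpha> \<noteq> 0 \<or> \<beta> \<noteq> 0" "eval3 F (\<alpha> *s v + \<beta> *s w) = 0"
proof (cases "eval3 F w = 0")
  case True
  then show ?thesis using that[of 0 1] by simp
next
  case False
  then have "degree (line_poly F v w) \<ge> n"
    by (metis degree_line_poly(2) hom le_degree)
  then obtain t where "poly (line_poly F v w) t = 0"
    using complex_poly_root assms(2) by (metis less_le_trans)
  then show ?thesis using that[of 1 t] by (simp add: poly_line_poly)
qed

lemma linear_form_zero:
  assumes hom: "homogeneous 1 F" and "eval3 F v = 0" "eval3 F w = 0"
  shows "eval3 F (\<alpha> *s v + \<beta> *s w) = 0"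
proof (cases "\<alpha> = 0")
  case True
  then show ?thesis using assms by (simp add: eval3_scale[OF hom])
next
  case False
  have "degree (line_poly F v w) \<le> 1" "coeff (line_poly F v w) 1 = 0" "coeff (line_poly F v w) 0 = 0"
    using degree_line_poly[OF hom] assms by (simp_all add: coeff_line_poly_0)
  then have "line_poly F v w = 0"
    by (auto simp: poly_eq_iff) (metis One_nat_def coeff_eq_0 le_less_trans less_one linorder_neqE_nat)
  then have "eval3 F (v + (\<beta> / \<alpha>) *s w) = 0" using poly_line_poly[of F v w "\<beta> / \<alpha>"] by simp
  moreover have "\<alpha> *s v + \<beta> *s w = \<alpha> *s (v + (\<beta> / \<alpha>) *s w)"
    using False by (simp add: vector_add_ldistrib)
  ultimately show ?thesis by (simp add: eval3_scale[OF hom])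
qed

lemma other_indices:
  fixes i :: 3
  obtains j k where "i \<noteq> j" "i \<noteq> k" "j \<noteq> k" "UNIV = {i, j, k}"
proof -
  have "(UNIV :: 3 set) = {1, 2, 3}" by (rule UNIV_3)
  then show ?thesis
    using exhaust_3[of i] that[of 2 3] that[of 1 3] that[of 1 2] by (auto simp: insert_commute)
qed

lemma line_common_zero:
  assumes G: "homogeneous 1 G" and H: "homogeneous n H" and n: "n > 0"
  obtains u where "u \<noteq> 0" "eval3 G u = 0" "eval3 H u = 0"
proof -
  let ?e = "\<lambda>i. axis i (1::complex) :: complex ^ 3"
  obtain \<alpha> \<beta> where ab: "\<alpha> \<noteq> 0 \<or> \<beta> \<noteq> 0" "eval3 G (\<alpha> *s ?e 1 + \<beta> *s ?e 2) = 0"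
    using zero_on_line[OF G zero_less_one] by blast
  define v where "v = \<alpha> *s ?e 1 + \<beta> *s ?e 2"
  have "v \<noteq> 0" using ab(1) by (auto simp: v_def vec_eq_iff forall_3 axis_def)
  then obtain i where i: "v $ i \<noteq> 0" by (auto simp: vec_eq_iff)
  \<comment> \<open>The second zero of \<open>G\<close> is sought on the coordinate line where entry
    \<open>i\<close> vanishes; since \<open>v $ i\<close> does not vanish, it is independent of
    \<open>v\<close>.\<close>
  obtain j k where jk: "i \<noteq> j" "i \<noteq> k" "j \<noteq> k" using other_indices by metis
  obtain \<gamma> \<delta> where cd: "\<gamma> \<noteq> 0 \<or> \<delta> \<noteq> 0" "eval3 G (\<gamma> *s ?e j + \<delta> *s ?e k) = 0"
    using zero_on_line[OF G zero_less_one] by blast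
  define w where "w = \<gamma> *s ?e j + \<delta> *s ?e k"
  have w: "w \<noteq> 0" "w $ i = 0"
    using cd(1) jk by (auto simp: w_def vec_eq_iff axis_def)
  obtain \<epsilon> \<zeta> where ez: "\<epsilon> \<noteq> 0 \<or> \<zeta> \<noteq> 0" "eval3 H (\<epsilon> *s v + \<zeta> *s w) = 0"
    using zero_on_line[OF H n] by blast
  have "\<epsilon> *s v + \<zeta> *s w \<noteq> 0"
  proof
    assume *: "\<epsilon> *s v + \<zeta> *s w = 0"
    then have "(\<epsilon> *s v + \<zeta> *s w) $ i = 0" by simp
    then have "\<epsilon> = 0" using w i by simp
    then show False using * ez w by simp
  qed
  moreover have "eval3 G (\<epsilon> *s v + \<zeta> *s w) = 0"
    using linear_form_zero[OF G] ab(2) cd(2) by (simp add: v_def w_def)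
  ultimately show ?thesis using that ez by blast
qed

text \<open>Here \<open>p\<close> is a point of the conic and \<open>B\<close> is the polar line form of \<open>p\<close>.\<close>

lemma conic_through_point:
  assumes G: "homogeneous 2 G" and p: "eval3 G p = 0"
    and B: "B = (\<Sum>i\<in>UNIV. [:[:[:p $ i:]:]:] * partial i G)"
  shows "eval3 G (\<alpha> *s p + \<beta> *s w) = \<beta> ^ 2 * eval3 G w + \<alpha> * \<beta> * eval3 B w"
proof (cases "\<beta> = 0")
  case True
  then show ?thesis using p by (simp add: eval3_scale[OF G])
next
  case False
  have "eval3 B w = (\<Sum>i\<in>UNIV. eval3 (partial i G) w * p $ i)"
    by (simp add: B eval3_def poly_sum mult.commute)
  \<comment> \<open>Along \<open>w + t p\<close> the constant term is \<open>G(w)\<close>, the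
    linear one is the polar form at \<open>w\<close>, and the quadratic one is
    \<open>G(p) = 0\<close>.\<close>
  then have 1: "coeff (line_poly G w p) 1 = eval3 B w" by (simp only: coeff_line_poly_1)
  have 2: "degree (line_poly G w p) \<le> 2" "coeff (line_poly G w p) 2 = 0"
    using degree_line_poly[OF G] p by simp_all
  have "line_poly G w p = [:eval3 G w, eval3 B w:]"
  proof (rule poly_eqI)
    fix n :: nat
    consider "n = 0" | "n = 1" | "n = 2" | "n > 2" by linarith
    then show "coeff (line_poly G w p) n = coeff [:eval3 G w, eval3 B w:] n"
    proof cases
      case 3
      then show ?thesis using 2(2) by (simp add: numeral_2_eq_2)
    next
      case 4
      then have "coeff (line_poly G w p) n = 0" using 2(1) by (intro coeff_eq_0) linarith
      moreover have "coeff [:eval3 G w, eval3 B w:] n = 0" using 4 by (intro coeff_eq_0) simp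
      ultimately show ?thesis by simp
    qed (use 1 in \<open>simp_all add: coeff_line_poly_0\<close>)
  qed
  then have "eval3 G (w + (\<alpha> / \<beta>) *s p) = eval3 G w + (\<alpha> / \<beta>) * eval3 B w"
    using poly_line_poly[of G w p "\<alpha> / \<beta>"] by simp
  moreover have "\<alpha> *s p + \<beta> *s w = \<beta> *s (w + (\<alpha> / \<beta>) *s p)"
    using False by (simp add: vector_add_ldistrib)
  ultimately have "eval3 G (\<alpha> *s p + \<beta> *s w) = \<beta> ^ 2 * (eval3 G w + (\<alpha> / \<beta>) * eval3 B w)"
    by (simp only: eval3_scale[OF G])
  also have "\<dots> = \<beta> ^ 2 * eval3 G w + \<alpha> * \<beta> * eval3 B w"
    using False by (simp add: power2_eq_square algebra_simps)
  finally show ?thesis .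
qed

text \<open>
  Projecting the conic from one of its points \<open>p\<close> gives a quadratic parametrisation; either it has
  no base point, and \<open>H\<close> pulls back to a binary form, or the conic contains a line through \<open>p\<close>.
\<close>

lemma conic_common_zero:
  assumes G: "homogeneous 2 G" and H: "homogeneous n H" and n: "n > 0"
  obtains u where "u \<noteq> 0" "eval3 G u = 0" "eval3 H u = 0"
proof -
  let ?e = "\<lambda>i. axis i (1::complex) :: complex ^ 3"
  obtain \<alpha> \<beta> where ab: "\<alpha> \<noteq> 0 \<or> \<beta> \<noteq> 0" "eval3 G (\<alpha> *s ?e 1 + \<beta> *s ?e 2) = 0"
    using zero_on_line[OF G zero_less_numeral] by blast
  define p where "p = \<alpha> *s ?e 1 + \<beta> *s ?e 2"
  have p: "p \<noteq> 0" "eval3 G p = 0" using ab by (auto simp: p_def vec_eq_iff forall_3 axis_def)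
  then obtain i where i: "p $ i \<noteq> 0" by (auto simp: vec_eq_iff)
  obtain j k where jk: "i \<noteq> j" "i \<noteq> k" "j \<noteq> k" using other_indices by metis
  define B where "B = (\<Sum>i\<in>UNIV. [:[:[:p $ i:]:]:] * partial i G)"
  have B: "homogeneous 1 B"
    unfolding B_def
  proof (rule homogeneous_sum)
    fix i :: 3
    have "homogeneous 0 (monom3 (p $ i) 0 0 0)" by (rule homogeneous_monom3) simp
    moreover have "homogeneous 1 (partial i G)" using homogeneous_partial[of 1 G] G by (simp add: numeral_2_eq_2)
    ultimately show "homogeneous 1 ([:[:[:p $ i:]:]:] * partial i G)"
      using homogeneous_mult[of 0 "[:[:[:p $ i:]:]:]" 1] by (simp add: monom3_def monom_0)
  qed
  note G_eq = conic_through_point[OF G p(2) B_def]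
  \<comment> \<open>The second intersection of the conic with the line joining \<open>p\<close> and
    \<open>w\<close>: these weights make
    \<open>\<beta> ^ 2 * eval3 G w + \<alpha> * \<beta> * eval3 B w\<close> vanish.\<close>
  define U where "U = (\<lambda>w. (- eval3 G w) *s p + eval3 B w *s w)"
  have GU: "eval3 G (U w) = 0" for w
    unfolding U_def G_eq by (simp add: power2_eq_square)
  show ?thesis
  proof (cases "\<exists>w. w \<noteq> 0 \<and> w $ i = 0 \<and> U w = 0")
    case True
    then obtain w where w: "w \<noteq> 0" "w $ i = 0" "U w = 0" by blast
    \<comment> \<open>At a base point, \<open>w $ i = 0\<close> reduces entry \<open>i\<close> of
      \<open>U w\<close> to \<open>- G(w) * p $ i\<close>. So \<open>G(w) = 0\<close>, then
      \<open>B(w) = 0\<close>, and the whole line through \<open>p\<close> and \<open>w\<close> lies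
      on the conic.\<close>
    then have "U w $ i = 0" by simp
    then have Gw: "eval3 G w = 0" using w i by (simp add: U_def)
    then have Bw: "eval3 B w = 0" using w by (auto simp: U_def)
    obtain \<epsilon> \<zeta> where ez: "\<epsilon> \<noteq> 0 \<or> \<zeta> \<noteq> 0" "eval3 H (\<epsilon> *s p + \<zeta> *s w) = 0"
      using zero_on_line[OF H n] by blast
    have "\<epsilon> *s p + \<zeta> *s w \<noteq> 0"
    proof
      assume *: "\<epsilon> *s p + \<zeta> *s w = 0"
      then have "(\<epsilon> *s p + \<zeta> *s w) $ i = 0" by simp
      then have "\<epsilon> = 0" using w i by simp
      then show False using * ez w by simp
    qed
    moreover have "eval3 G (\<epsilon> *s p + \<zeta> *s w) = 0" by (simp add: G_eq Gw Bw)
    ultimately show ?thesis using that ez by blast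
  next
    case False
    \<comment> \<open>The directions \<open>w\<close> run through
      \<open>axis j 1 + t axis k 1\<close>, with \<open>axis k 1\<close> at infinity;
      \<open>a\<close> collects the coordinates of \<open>U\<close> as polynomials in
      \<open>t\<close> of degree at most 2.\<close>
    define g b where "g = line_poly G (?e j) (?e k)" and "b = line_poly B (?e j) (?e k)"
    define a :: "complex poly ^ 3" where "a = (\<chi> l. - smult (p $ l) g + b * [:?e j $ l, ?e k $ l:])"
    have g: "degree g \<le> 2" "coeff g 2 = eval3 G (?e k)"
      and b: "degree b \<le> 1" "coeff b 1 = eval3 B (?e k)"
      using degree_line_poly[OF G] degree_line_poly[OF B] by (simp_all add: g_def b_def)
    have bl: "degree (b * [:?e j $ l, ?e k $ l:]) \<le> 2 \<and>
        coeff (b * [:?e j $ l, ?e k $ l:]) 2 = eval3 B (?e k) * ?e k $ l" for l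
      using coeff_mult_bound[OF b(1), of "[:?e j $ l, ?e k $ l:]" 1] b
      by (simp add: numeral_2_eq_2 degree_pCons_eq_if)
    have deg: "degree (a $ l) \<le> 2" for l
      unfolding a_def vec_lambda_beta using g(1) degree_smult_le[of "p $ l" g]
      by (intro degree_add_le bl[THEN conjunct1]) simp
    have top: "(\<chi> l. coeff (a $ l) 2) = U (?e k)"
      using bl g by (simp add: a_def U_def vec_eq_iff mult.commute)
    have at: "(\<chi> l. poly (a $ l) t) = U (?e j + t *s ?e k)" for t
      by (simp add: a_def U_def vec_eq_iff g_def b_def poly_line_poly algebra_simps)
    have nz: "U (?e k) \<noteq> 0" "U (?e j + t *s ?e k) \<noteq> 0" for t
    proof -
      have "?e k \<noteq> 0" "?e k $ i = 0" using jk by (auto simp: axis_eq_0_iff) (auto simp: axis_def)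
      then show "U (?e k) \<noteq> 0" using False by blast
      have "(?e j + t *s ?e k) $ j \<noteq> 0" "(?e j + t *s ?e k) $ i = 0"
        using jk by (auto simp: axis_def)
      then show "U (?e j + t *s ?e k) \<noteq> 0" using False by (metis zero_index)
    qed
    define h where "h = ev (\<lambda>c. [:c:]) H a"
    have h: "degree h \<le> n * 2" "coeff h (n * 2) = eval3 H (U (?e k))"
      using ev_poly_top_coeff[OF H deg] top by (simp_all add: h_def)
    show ?thesis
    proof (cases "degree h = 0")
      \<comment> \<open>A constant pull-back has coefficient 0 at \<open>n * 2\<close>, so the
        common zero sits at the parameter infinity.\<close>
      case True
      then have "coeff h (n * 2) = 0" using n by (simp add: coeff_eq_0)
      then show ?thesis using h GU nz that by metis
    next
      case False
      then obtain t where "poly h t = 0" using complex_poly_root by blast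
      then have "eval3 H (U (?e j + t *s ?e k)) = 0" by (simp add: h_def poly_ev at)
      then show ?thesis using GU nz that by metis
    qed
  qed
qed

section \<open>Consequences of nonsingularity\<close>

lemma eval3_mult: "eval3 (F * G) v = eval3 F v * eval3 G v"
  by (simp add: eval3_def)

lemma nonsingular_nonzero: "nonsingular_plane_quartic F \<Longrightarrow> F \<noteq> 0"
proof
  assume "nonsingular_plane_quartic F" "F = 0"
  moreover have "axis 1 1 \<noteq> (0 :: complex ^ 3)" by (simp add: axis_eq_0_iff)
  ultimately obtain i where "eval3 (partial i F) (axis 1 1) \<noteq> 0"
    using nonsingular_gradient by (metis eval3_def poly_0)
  then show False using \<open>F = 0\<close> by (simp add: partial_def eval3_def split: if_splits)
qed

text \<open>The line from \<open>v\<close> in the direction \<open>v\<close> stays on the multiples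
  of \<open>v\<close>, where \<open>F\<close> is 0; its linear coefficient is Euler's sum.\<close>

lemma euler_zero:
  assumes "homogeneous n F" "eval3 F v = 0"
  shows "(\<Sum>i\<in>UNIV. eval3 (partial i F) v * v $ i) = 0"
proof -
  have "v + t *s v = (1 + t) *s v" for t by (simp add: vector_sadd_rdistrib)
  then have "poly (line_poly F v v) t = 0" for t
    by (simp add: poly_line_poly eval3_scale[OF assms(1)] assms(2))
  then have "line_poly F v v = 0" using poly_all_0_iff_0 by blast
  then show ?thesis by (simp flip: coeff_line_poly_1)
qed

lemma partial_axis: "eval3 (partial i F) v = coeff (line_poly F v (axis i 1)) 1"
  unfolding coeff_line_poly_1 by (simp add: axis_def if_distrib sum.delta cong: if_cong)

text \<open>Along every line through a common zero both restrictions lack a constant term, so their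
  product lacks a linear one and the gradient vanishes.\<close>

lemma nonsingular_no_common_zero:
  assumes "nonsingular_plane_quartic (G * H)" "u \<noteq> 0" "eval3 G u = 0" "eval3 H u = 0"
  shows False
proof -
  obtain i where "eval3 (partial i (G * H)) u \<noteq> 0"
    using nonsingular_gradient[OF assms(1,2)] assms(3) by (auto simp: eval3_mult)
  moreover have "line_poly (G * H) u w = line_poly G u w * line_poly H u w" for w
    by (simp add: line_poly_def ev_mult ring_map_pCons)
  ultimately show False
    using assms(3,4) by (simp add: partial_axis coeff_mult coeff_line_poly_0)
qed

lemma nonsingular_irreducible:
  assumes ns: "nonsingular_plane_quartic F"
  shows "irreducible F"
proof (rule irreducibleI)
  show "F \<noteq> 0" by (rule nonsingular_nonzero) fact
  show "\<not> F dvd 1"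
    by (rule not_dvd_lower_degree[OF nonsingular_homogeneous[OF ns] homogeneous_1]) auto
next
  fix G H assume F: "F = G * H"
  have nz: "G * H \<noteq> 0" using nonsingular_nonzero[OF ns] F by simp
  obtain a b where ab: "homogeneous a G" "homogeneous b H" "a + b = 4"
    using homogeneous_factors[of 4 G H] nonsingular_homogeneous[OF ns] nz unfolding F by blast
  have *: False if "homogeneous a G" "homogeneous b H" "a = 1 \<or> a = 2" "b > 0" "F = G * H" for a b G H
    using that line_common_zero[of G b H] conic_common_zero[of G b H]
      nonsingular_no_common_zero ns by metis
  consider "a = 0" | "b = 0" | "a = 1 \<or> a = 2" "b > 0" | "b = 1 \<or> b = 2" "a > 0"
    using ab(3) by linarith
  then show "G dvd 1 \<or> H dvd 1"
  proof cases
    case 1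
    then show ?thesis using ab nz homogeneous_0_unit by auto
  next
    case 2
    then show ?thesis using ab nz homogeneous_0_unit by auto
  next
    case 3
    then show ?thesis using *[OF ab(1,2)] F by blast
  next
    case 4
    then show ?thesis using *[OF ab(2,1)] F by (simp add: mult.commute)
  qed
qed

lemma nonsingular_prime: "nonsingular_plane_quartic F \<Longrightarrow> prime_elem F"
  by (rule irreducible_imp_prime_elem[OF nonsingular_irreducible])

lemma nonsingular_dvd_multD:
  "nonsingular_plane_quartic F \<Longrightarrow> F dvd G * H \<Longrightarrow> F dvd G \<or> F dvd H"
  using prime_elem_dvd_multD[OF nonsingular_prime] .

text \<open>
  On a line contained in the curve the gradient is a multiple of the equation of the line, and one of
  its coordinates, a binary cubic form, has a zero there.
\<close>

lemma no_line_in_nonsingular: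
  assumes ns: "nonsingular_plane_quartic F"
    and indep: "v $ i * w $ j \<noteq> v $ j * w $ i"
    and zero: "\<And>\<alpha> \<beta>. eval3 F (\<alpha> *s v + \<beta> *s w) = 0"
  shows False
proof -
  have ij: "i \<noteq> j" using indep by auto
  obtain l where l: "UNIV = {i, j, l}" "l \<noteq> i" "l \<noteq> j"
  proof -
    obtain k l where "i \<noteq> k" "i \<noteq> l" "k \<noteq> l" "UNIV = {i, k, l}" using other_indices .
    moreover have "j \<in> {i, k, l}" using calculation(4) by blast
    ultimately show ?thesis using that[of k] that[of l] ij by (metis insertE insert_commute singletonD)
  qed
  have hom: "homogeneous 3 (partial l F)"
    using homogeneous_partial[of 3 F l] nonsingular_homogeneous[OF ns] by simp
  obtain \<alpha> \<beta> where ab: "\<alpha> \<noteq> 0 \<or> \<beta> \<noteq> 0" "eval3 (partial l F) (\<alpha> *s v + \<beta> *s w) = 0"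
    using zero_on_line[OF hom zero_less_numeral] by blast
  define u where "u = \<alpha> *s v + \<beta> *s w"
  have "u \<noteq> 0"
  proof
    assume "u = 0"
    then have "u $ i = 0" "u $ j = 0" by auto
    then have "\<alpha> * (v $ i * w $ j - v $ j * w $ i) = 0" "\<beta> * (v $ i * w $ j - v $ j * w $ i) = 0"
      unfolding u_def vector_add_component vector_smult_component by algebra+
    then show False using ab(1) indep by simp
  qed
  have "u + t *s v = (\<alpha> + t) *s v + \<beta> *s w" "u + t *s w = \<alpha> *s v + (\<beta> + t) *s w" for t
    by (simp_all add: u_def vector_sadd_rdistrib add.commute add.left_commute)
  \<comment> \<open>Both directions stay inside the curve, so the gradient at \<open>u\<close> is
    orthogonal to \<open>v\<close> and \<open>w\<close>. Its entry \<open>l\<close> is 0 by the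
    choice of \<open>u\<close>, and the nonzero minor then kills the entries \<open>i\<close> and
    \<open>j\<close>.\<close>
  then have "line_poly F u v = 0" "line_poly F u w = 0"
    using zero by (simp_all add: poly_line_poly flip: poly_all_0_iff_0)
  then have *: "(\<Sum>i\<in>UNIV. eval3 (partial i F) u * v $ i) = 0" "(\<Sum>i\<in>UNIV. eval3 (partial i F) u * w $ i) = 0"
    by (metis coeff_0 coeff_line_poly_1)+
  have gl: "eval3 (partial l F) u = 0" using ab by (simp add: u_def)
  have sum: "(\<Sum>m\<in>UNIV. f m) = f i + f j + f l" for f :: "3 \<Rightarrow> complex"
    by (subst l(1)) (use l(2,3) ij in \<open>simp add: add.assoc\<close>)
  have "eval3 (partial i F) u * v $ i + eval3 (partial j F) u * v $ j = 0"
    "eval3 (partial i F) u * w $ i + eval3 (partial j F) u * w $ j = 0"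
    using * gl unfolding sum by simp_all
  then have "eval3 (partial i F) u * (v $ i * w $ j - v $ j * w $ i) = 0"
    "eval3 (partial j F) u * (v $ i * w $ j - v $ j * w $ i) = 0"
    by algebra+
  then have zeros: "eval3 (partial i F) u = 0" "eval3 (partial j F) u = 0" using indep by simp_all
  have "eval3 (partial m F) u = 0" for m
  proof -
    have "m \<in> {i, j, l}" using l(1) by blast
    then show ?thesis using zeros gl by auto
  qed
  then show False
    using nonsingular_gradient[OF ns \<open>u \<noteq> 0\<close>] zero[of \<alpha> \<beta>] by (metis u_def)
qed

section \<open>Common zeros over extension fields\<close>

text \<open>An ideal member of least degree divides a nonzero multiple \<open>[:c:] * F\<close>, by pseudo-division.\<close>

lemma prime_elimination:
  fixes F G :: "'a::idom poly"
  assumes prime: "prime_elem F" and G: "\<not> F dvd G"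
  obtains r U V where "r \<noteq> 0" "[:r:] = U * F + V * G"
proof -
  define I where "I = {U * F + V * G | U V. True}"
  have F0: "F \<noteq> 0" using prime by auto
  have "F = 1 * F + 0 * G" "G = 0 * F + 1 * G" by simp_all
  then have FI: "F \<in> I" and GI: "G \<in> I" unfolding I_def by blast+
  \<comment> \<open>Exactly the closure needed to keep pseudo-remainders inside the ideal.\<close>
  have smult: "smult c x - y * z \<in> I" if xy: "x \<in> I" "y \<in> I" for c x y z
  proof -
    obtain U V U' V' where "x = U * F + V * G" "y = U' * F + V' * G" using xy unfolding I_def by blast
    then have "smult c x - y * z = (smult c U - U' * z) * F + (smult c V - V' * z) * G"
      by (simp add: algebra_simps smult_add_right)
    then show ?thesis unfolding I_def by blast
  qed
  obtain S where S: "S \<in> I" "S \<noteq> 0" and min: "\<And>T. T \<in> I \<Longrightarrow> T \<noteq> 0 \<Longrightarrow> degree S \<le> degree T"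
    using ex_has_least_nat[of "\<lambda>S. S \<in> I \<and> S \<noteq> 0" F degree] FI F0 by blast
  have reduce: "\<exists>c q. c \<noteq> 0 \<and> smult c T = S * q" if "T \<in> I" for T
  proof -
    obtain q r where qr: "pseudo_divmod T S = (q, r)" by fastforce
    define c where "c = coeff S (degree S) ^ (Suc (degree T) - degree S)"
    have eq: "smult c T = S * q + r" and r: "r = 0 \<or> degree r < degree S"
      using pseudo_divmod[OF S(2) qr] by (simp_all add: c_def)
    have "r \<in> I" using smult[OF that S(1), of c q] eq by simp
    then have "r = 0" using r min by fastforce
    moreover have "c \<noteq> 0" using S(2) by (simp add: c_def)
    ultimately show ?thesis using eq by auto
  qed
  have "degree S = 0"
  proof (rule ccontr)
    assume pos: "degree S \<noteq> 0"
    then have dF: "degree F > 0" using min[OF FI F0] by simp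
    have F_const: False if "c \<noteq> 0" "F dvd [:c:]" for c
      using dvd_imp_degree_le[OF that(2)] that(1) dF by simp
    obtain c q where c: "c \<noteq> 0" "smult c F = S * q" using reduce[OF FI] by blast
    \<comment> \<open>If \<open>F\<close> divided \<open>S\<close>, it would divide a constant
      multiple of \<open>G\<close>, which primality excludes because \<open>F\<close> has positive
      degree. If it divided \<open>q\<close>, cancelling \<open>F\<close> would make
      \<open>S\<close> divide a nonzero constant.\<close>
    have "F dvd S * q" by (metis c(2) dvd_refl dvd_smult)
    then consider "F dvd S" | "F dvd q" using prime_elem_dvd_multD[OF prime] by blast
    then show False
    proof cases
      case 1
      obtain c' q' where c': "c' \<noteq> 0" "smult c' G = S * q'" using reduce[OF GI] by blast
      then have "F dvd [:c':] * G" using 1 by simp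
      then show False using prime_elem_dvd_multD[OF prime] F_const c'(1) G by blast
    next
      case 2
      then obtain q' where "q = F * q'" by auto
      then have "F * [:c:] = F * (S * q')" using c(2) by (simp add: algebra_simps)
      then have "[:c:] = S * q'" using mult_left_cancel[OF F0] by blast
      then have "S dvd [:c:]" by (rule dvdI)
      then have "degree S \<le> degree [:c:]" using c(1) by (intro dvd_imp_degree_le) simp_all
      then show False using pos by simp
    qed
  qed
  then obtain r where "S = [:r:]" by (rule degree_eq_zeroE)
  moreover have "r \<noteq> 0" using calculation S(2) by simp
  ultimately show ?thesis using S(1) that by (auto simp: I_def)
qed

lemma ring_map_eq_0_iff:
  fixes h :: "'a::field \<Rightarrow> 'b::idom"
  assumes "ring_map h"
  shows "h c = 0 \<longleftrightarrow> c = 0"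
proof
  assume "h c = 0"
  then have "h (c * inverse c) = 0" by (simp add: ring_map_mult[OF assms])
  then show "c = 0" by (cases "c = 0") (simp_all add: ring_map_1[OF assms])
qed (simp add: ring_map_0[OF assms])

text \<open>The polynomial splits into complex linear factors, and in a domain one of them must
  vanish at \<open>x\<close>.\<close>

lemma algebraic_over_complex:
  fixes h :: "complex \<Rightarrow> 'k::idom"
  assumes h: "ring_map h" and "p \<noteq> 0" and "poly (map_poly h p) x = 0"
  shows "\<exists>c. x = h c"
  using assms(2,3)
proof (induction "degree p" arbitrary: p)
  case 0
  then obtain c where c: "p = [:c:]" "c \<noteq> 0" by (metis degree_eq_zeroE pCons_0_0)
  then have "h c = 0" using 0 by (simp add: map_poly_pCons ring_map_0[OF h])
  then show ?case using c(2) by (simp add: ring_map_eq_0_iff[OF h])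
next
  case (Suc n)
  then obtain c where "poly p c = 0" using complex_poly_root by (metis zero_less_Suc)
  then obtain q where q: "p = [:- c, 1:] * q" by (auto simp: poly_eq_0_iff_dvd)
  have deg: "degree p = Suc (degree q)"
    using Suc.prems(1) unfolding q by (subst degree_mult_eq) auto
  have "(- h c + x) * poly (map_poly h q) x = 0"
    using Suc.prems(2) ring_map_mult[OF ring_map_poly[OF h, of x], of "[:- c, 1:]" q]
    by (simp add: q map_poly_pCons ring_map_0[OF h] ring_map_1[OF h] ring_map_uminus[OF h])
  moreover have "q \<noteq> 0" using Suc.prems(1) q by auto
  ultimately show ?case
    using Suc.hyps(1)[of q] Suc.hyps(2) deg by (auto simp: add_eq_0_iff)
qed

lemma poly_map_poly_line_poly:
  assumes "ring_map h"
  shows "poly (map_poly h (line_poly F v w)) t = ev h F (\<chi> i. h (v $ i) + t * h (w $ i))"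
  unfolding line_poly_def
  by (subst ev_compose[OF ring_map_poly[OF assms] ring_map_pCons])
    (simp add: map_poly_pCons ring_map_0[OF assms])

text \<open>
  Two forms without common component meet only in complex points, also over extension fields:
  eliminating \<open>x\<close> forces \<open>y : z\<close> to be complex, and then the restriction of \<open>F\<close> to the corresponding
  line forces \<open>x\<close> to be complex as well.
\<close>

lemma common_zero_complex:
  fixes h :: "complex \<Rightarrow> 'k::field"
  assumes ns: "nonsingular_plane_quartic F" and G: "homogeneous n G" "\<not> F dvd G"
    and h: "ring_map h" and F0: "ev h F w = 0" and G0: "ev h G w = 0"
  shows "\<exists>\<kappa> u. \<forall>i. w $ i = \<kappa> * h (u $ i)"
proof (cases "w $ 2 = 0 \<and> w $ 3 = 0")
  case True
  then show ?thesis
    by (intro exI[of _ "w $ 1"] exI[of _ "axis 1 1"])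
      (simp add: forall_3 axis_def ring_map_0[OF h] ring_map_1[OF h])
next
  case False
  have F4: "homogeneous 4 F" by (rule nonsingular_homogeneous[OF ns])
  obtain r U V where r: "r \<noteq> 0" and rUV: "[:r:] = U * F + V * G"
    using prime_elimination[OF nonsingular_prime[OF ns] G(2)] .
  \<comment> \<open>\<open>r\<close> is free of \<open>x\<close> but need not be homogeneous. As all
    multiples of \<open>w\<close> are common zeros, it vanishes on every one of them, which leaves
    the scaling free for normalising the last coordinate.\<close>
  have ev_r: "ev h [:r:] (\<chi> i. \<mu> * w $ i) = 0" for \<mu>
    unfolding rUV by (simp add: ev_add[OF h] ev_mult[OF h] ev_scale[OF F4 h] ev_scale[OF G(1) h] F0 G0)
  obtain \<kappa> \<beta> \<gamma> where \<kappa>: "\<kappa> \<noteq> 0" "w $ 2 = \<kappa> * h \<beta>" "w $ 3 = \<kappa> * h \<gamma>"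
  proof (cases "w $ 3 = 0")
    case True
    then show ?thesis using False that[of "w $ 2" 1 0] by (simp add: ring_map_0[OF h] ring_map_1[OF h])
  next
    case w3: False
    obtain j where j: "coeff r j \<noteq> 0" using r by (auto simp: poly_eq_iff)
    \<comment> \<open>The extra factor forces the chosen \<open>l\<close> to be nonzero, so that
      \<open>w\<close> can be scaled to have last coordinate \<open>h l\<close>. Putting
      \<open>z = l\<close> then keeps \<open>r\<close> nonzero and leaves a complex polynomial in
      \<open>y\<close>.\<close>
    then have "coeff r j * [:0, 1:] \<noteq> 0" by simp
    then obtain l where l: "poly (coeff r j * [:0, 1:]) l \<noteq> 0" using poly_all_0_iff_0 by blast
    define p where "p = map_poly (\<lambda>s. poly s l) r"
    have "coeff p j \<noteq> 0" using l by (simp add: p_def coeff_map_poly)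
    then have p0: "p \<noteq> 0" by auto
    have hl: "h l \<noteq> 0" using l by (auto simp: ring_map_eq_0_iff[OF h])
    define y where "y = h l / w $ 3 * w $ 2"
    have poly_h: "poly (map_poly h s) (h l) = h (poly s l)" for s
      by (induction s) (simp_all add: map_poly_pCons ring_map_0[OF h] ring_map_add[OF h] ring_map_mult[OF h])
    have "ev h [:r:] (\<chi> i. (h l / w $ 3) * w $ i) = poly (map_poly h p) y"
      using w3 by (simp add: ev_def map_poly_pCons p_def map_poly_map_poly o_def poly_h y_def ring_map_0[OF h])
    then have "poly (map_poly h p) y = 0" using ev_r by metis
    then obtain c where "y = h c" using algebraic_over_complex[OF h p0] by blast
    then have "w $ 2 = (w $ 3 / h l) * h c" "w $ 3 = (w $ 3 / h l) * h l"
      using w3 hl by (simp_all add: y_def field_simps)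
    then show ?thesis using w3 hl by (intro that[of "w $ 3 / h l" c l]) auto
  qed
  define v :: "complex ^ 3" where "v = (\<chi> i. if i = 1 then 0 else if i = 2 then \<beta> else \<gamma>)"
  \<comment> \<open>With \<open>v = (0, \<beta>, \<gamma>)\<close>, the point
    \<open>w / \<kappa>\<close> lies on the line through \<open>v\<close> and
    \<open>(1, 0, 0)\<close>. The quartic contains no line, so \<open>f\<close> is a nonzero complex
    polynomial with root \<open>w $ 1 / \<kappa>\<close>.\<close>
  define f where "f = line_poly F v (axis 1 1)"
  have f0: "f \<noteq> 0"
  proof
    assume f: "f = 0"
    have zero: "eval3 F (v + t *s axis 1 1) = 0" for t
      using poly_line_poly[of F v "axis 1 1" t] f by (simp add: f_def)
    have axis: "eval3 F (axis 1 1) = 0"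
      using degree_line_poly(2)[OF F4, of v "axis 1 1"] f by (simp add: f_def)
    have all: "eval3 F (s *s axis 1 1 + t *s v) = 0" for s t
    proof (cases "t = 0")
      case True
      then show ?thesis using axis by (simp add: eval3_scale[OF F4])
    next
      case False
      then have "s *s axis 1 1 + t *s v = t *s (v + (s / t) *s axis 1 1)"
        by (simp add: vector_add_ldistrib add.commute)
      then show ?thesis using zero[of "s / t"] by (simp only: eval3_scale[OF F4]) simp
    qed
    have "\<beta> \<noteq> 0 \<or> \<gamma> \<noteq> 0" using False \<kappa> by (auto simp: ring_map_0[OF h])
    then show False
      using no_line_in_nonsingular[OF ns _ all, of 1 2] no_line_in_nonsingular[OF ns _ all, of 1 3]
      by (auto simp: v_def axis_def)
  qed
  have "(\<chi> i. h (v $ i) + w $ 1 / \<kappa> * h (axis 1 1 $ i)) = (\<chi> i. inverse \<kappa> * w $ i)"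
    using \<kappa> by (simp add: vec_eq_iff forall_3 v_def axis_def ring_map_0[OF h] ring_map_1[OF h] field_simps)
  then have "poly (map_poly h f) (w $ 1 / \<kappa>) = 0"
    by (simp add: f_def poly_map_poly_line_poly[OF h] ev_scale[OF F4 h] F0)
  then obtain c where "w $ 1 / \<kappa> = h c" using algebraic_over_complex[OF h f0] by blast
  then have "w $ i = \<kappa> * h ((v + c *s axis 1 1) $ i)" for i
    using \<kappa> exhaust_3[of i] by (auto simp: v_def axis_def field_simps)
  then show ?thesis by blast
qed

lemma ring_map_fls_const: "ring_map (fls_const :: complex \<Rightarrow> complex fls)"
  unfolding ring_map_def
  by (simp add: fls_plus_const fls_const_mult_const)

lemma ring_map_fps_to_fls: "ring_map (fps_to_fls :: complex fps \<Rightarrow> complex fls)"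
  by (simp add: ring_map_def fls_times_fps_to_fls)

text \<open>Otherwise the branch, read over the field of Laurent series, would be proportional to a
  complex point. The entry \<open>1\<close> makes the factor complex, hence entry \<open>j\<close>
  constant, although it has the linear term \<open>X\<close>.\<close>

lemma branch_determines_component:
  fixes a :: "complex fps ^ 3"
  assumes ns: "nonsingular_plane_quartic F" and G: "homogeneous n G"
    and F0: "ev fps_const F a = 0" and G0: "ev fps_const G a = 0"
    and a: "a $ i = 1" "a $ j = fps_const c + fps_X"
  shows "F dvd G"
proof (rule ccontr)
  assume nd: "\<not> F dvd G"
  define w where "w = (\<chi> l. fps_to_fls (a $ l))"
  have ev_w: "ev fls_const H w = fps_to_fls (ev fps_const H a)" for H
    using ev_compose[OF ring_map_fps_to_fls ring_map_fps_const, of H a] by (simp add: w_def)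
  obtain \<kappa> u where u: "\<And>l. w $ l = \<kappa> * fls_const (u $ l)"
    using common_zero_complex[OF ns G nd ring_map_fls_const, of w] F0 G0 by (auto simp: ev_w)
  have 1: "\<kappa> * fls_const (u $ i) = 1" using u[of i] by (simp add: w_def a)
  then have ui: "u $ i \<noteq> 0" by auto
  have "\<kappa> = \<kappa> * fls_const (u $ i) * fls_const (inverse (u $ i))"
    using ui by (simp add: mult.assoc fls_const_mult_const)
  then have "\<kappa> = fls_const (inverse (u $ i))" using 1 by simp
  then have "w $ j = fps_to_fls (fps_const (inverse (u $ i) * u $ j))"
    using u[of j] by (simp add: fls_const_mult_const)
  then have "fps_const c + fps_X = fps_const (inverse (u $ i) * u $ j)"
    by (simp only: w_def vec_lambda_beta a fps_to_fls_eq_iff)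
  then have "fps_nth (fps_const c + fps_X) 1 = fps_nth (fps_const (inverse (u $ i) * u $ j)) 1" by metis
  then show False by simp
qed

section \<open>Formal branches and local rings\<close>

lemma fps_X_power_dvd_iff:
  fixes f :: "'a::comm_ring_1 fps"
  shows "fps_X ^ n dvd f \<longleftrightarrow> (\<forall>m<n. fps_nth f m = 0)"
proof
  assume "\<forall>m<n. fps_nth f m = 0"
  then have "f = fps_X ^ n * fps_shift n f"
    by (intro fps_ext) (simp add: fps_X_power_mult_nth)
  then show "fps_X ^ n dvd f" by (rule dvdI)
qed (auto simp: fps_X_power_mult_nth elim!: dvdE)

lemma poly_taylor_dvd:
  fixes q :: "'a::idom poly"
  shows "b ^ 2 dvd poly q (a + b) - poly q a - b * poly (pderiv q) a"
proof (induction q)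
  case (pCons c q)
  then obtain r where r: "poly q (a + b) - poly q a - b * poly (pderiv q) a = b ^ 2 * r" by auto
  have "poly (pCons c q) (a + b) - poly (pCons c q) a - b * poly (pderiv (pCons c q)) a =
      (a + b) * (poly q (a + b) - poly q a - b * poly (pderiv q) a) + b ^ 2 * poly (pderiv q) a"
    by (simp add: pderiv_pCons algebra_simps power2_eq_square)
  also have "\<dots> = b ^ 2 * ((a + b) * r + poly (pderiv q) a)"
    unfolding r by (simp add: algebra_simps)
  finally show ?case by simp
qed simp

lemma poly_diff_dvd:
  fixes q :: "'a::comm_ring_1 poly"
  shows "a - b dvd poly q a - poly q b"
proof (induction q)
  case (pCons c q)
  then obtain r where r: "poly q a - poly q b = (a - b) * r" by auto
  have "poly (pCons c q) a - poly (pCons c q) b = a * (poly q a - poly q b) + (a - b) * poly q b"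
    by (simp add: algebra_simps)
  also have "\<dots> = (a - b) * (a * r + poly q b)" unfolding r by (simp add: algebra_simps)
  finally show ?case by simp
qed simp

lemma fps_nth_poly_cong:
  fixes q :: "'a::comm_ring_1 fps poly"
  assumes "\<And>m. m \<le> n \<Longrightarrow> fps_nth f m = fps_nth g m" and "m \<le> n"
  shows "fps_nth (poly q f) m = fps_nth (poly q g) m"
proof -
  have "fps_X ^ Suc n dvd f - g" using assms(1) by (simp add: fps_X_power_dvd_iff del: power_Suc)
  then have "fps_X ^ Suc n dvd poly q f - poly q g" using poly_diff_dvd dvd_trans by blast
  then have "fps_nth (poly q f - poly q g) m = 0" using assms(2) unfolding fps_X_power_dvd_iff by simp
  then show ?thesis by simp
qed

text \<open>Newton's method, gaining one coefficient per step, with the slope kept at its constant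
  term \<open>c\<close>.\<close>

lemma fps_hensel:
  fixes q :: "'a::field fps poly"
  assumes root: "fps_nth (poly q 0) 0 = 0" and simple: "fps_nth (poly (pderiv q) 0) 0 \<noteq> 0"
  obtains s where "fps_nth s 0 = 0" "poly q s = 0"
proof -
  define c where "c = fps_nth (poly (pderiv q) 0) 0"
  \<comment> \<open>The correction cancels the first coefficient of \<open>poly q s\<close> that is
    not yet known to vanish.\<close>
  define S where "S = rec_nat (0::'a fps)
    (\<lambda>n s. s + fps_X ^ Suc n * fps_const (- fps_nth (poly q s) (Suc n) / c))"
  have S_Suc: "S (Suc n) = S n + fps_X ^ Suc n * fps_const (- fps_nth (poly q (S n)) (Suc n) / c)" for n
    by (simp add: S_def)
  have S0: "fps_nth (S n) 0 = 0" for n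
    by (induction n) (simp_all add: S_Suc fps_X_power_mult_nth del: power_Suc, simp add: S_def)
  have step: "fps_nth (S (Suc n)) m = fps_nth (S n) m" if "m \<le> n" for n m
    using that by (simp add: S_Suc fps_X_power_mult_nth del: power_Suc)
  have stable: "fps_nth (S (n + k)) m = fps_nth (S n) m" if "m \<le> n" for n m k
    using that by (induction k) (simp_all add: step)
  have zero: "\<forall>m\<le>n. fps_nth (poly q (S n)) m = 0" for n
  proof (induction n)
    case 0
    then show ?case using root by (simp add: S_def)
  next
    case (Suc n)
    define b where "b = fps_X ^ Suc n * fps_const (- fps_nth (poly q (S n)) (Suc n) / c)"
    \<comment> \<open>The quadratic Taylor remainder starts in degree \<open>2 * Suc n\<close>,
      beyond \<open>Suc n\<close>, so only the linear term reaches the coefficients in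
      question.\<close>
    have "fps_X ^ (2 * Suc n) dvd b ^ 2"
      unfolding b_def power_mult_distrib by (simp add: power_mult[symmetric] mult.commute del: power_Suc)
    then have "fps_X ^ (2 * Suc n) dvd poly q (S n + b) - poly q (S n) - b * poly (pderiv q) (S n)"
      using poly_taylor_dvd dvd_trans by blast
    then have "fps_nth (poly q (S n + b) - poly q (S n) - b * poly (pderiv q) (S n)) m = 0"
      if "m \<le> Suc n" for m
      using that unfolding fps_X_power_dvd_iff by simp
    then have *: "fps_nth (poly q (S (Suc n))) m =
        fps_nth (poly q (S n)) m + fps_nth (b * poly (pderiv q) (S n)) m" if "m \<le> Suc n" for m
      using that unfolding S_Suc b_def[symmetric] by (simp add: algebra_simps)
    have "fps_nth (poly (pderiv q) (S n)) 0 = c"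
      using fps_nth_poly_cong[of 0 "S n" 0 0 "pderiv q"] by (simp add: S0 c_def)
    then have b: "fps_nth (b * poly (pderiv q) (S n)) m =
        (if m = Suc n then - fps_nth (poly q (S n)) (Suc n) else 0)" if "m \<le> Suc n" for m
      using that simple unfolding b_def mult.assoc
      by (simp add: fps_X_power_mult_nth c_def del: power_Suc)
    show ?case using Suc by (auto simp: * b le_Suc_eq)
  qed
  \<comment> \<open>The coefficients stabilise, so the diagonal is the limit.\<close>
  define s where "s = Abs_fps (\<lambda>m. fps_nth (S m) m)"
  have s: "fps_nth s m = fps_nth (S n) m" if "m \<le> n" for m n
    using stable[of m m "n - m"] that by (simp add: s_def)
  have "fps_nth (poly q s) n = 0" for n
    using fps_nth_poly_cong[of n s "S n" n q] s zero by simp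
  then have "poly q s = 0" by (simp add: fps_eq_iff)
  moreover have "fps_nth s 0 = 0" by (simp add: s_def S0)
  ultimately show ?thesis using that by blast
qed

section \<open>Coordinates and expansion of forms at a point\<close>

lemma ev_coord: "ring_map h \<Longrightarrow> ev h (coord l) a = a $ l"
  using exhaust_3[of l] by (auto simp: coord_def ev_monom3 ring_map_1)

lemma eval3_coord: "eval3 (coord l) v = v $ l"
  by (simp add: eval3_eq_ev ev_coord ring_map_id)

lemma homogeneous_coord: "homogeneous 1 (coord l)"
  using exhaust_3[of l] by (auto simp: coord_def intro!: homogeneous_monom3)

lemma homogeneous_const: "homogeneous 0 (monom3 c 0 0 0)"
  by (rule homogeneous_monom3) simp

lemma monom3_eq_coord: "monom3 c i j k = monom3 c 0 0 0 * coord 1 ^ i * coord 2 ^ j * coord 3 ^ k"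
  by (simp add: coord_def monom3_power monom3_mult)

lemma homogeneous_uminus: "homogeneous n F \<Longrightarrow> homogeneous n (- F)"
  by (simp add: homogeneous_def)

lemma homogeneous_diff: "homogeneous n F \<Longrightarrow> homogeneous n G \<Longrightarrow> homogeneous n (F - G)"
  using homogeneous_add[of n F "- G"] homogeneous_uminus[of n G] by simp

lemma homogeneous_const_mult: "homogeneous n F \<Longrightarrow> homogeneous n (monom3 c 0 0 0 * F)"
  using homogeneous_mult[OF homogeneous_const, of n F c] by simp

text \<open>An affine chart \<open>v $ i = 1\<close> of the plane with coordinates \<open>lin j\<close>, \<open>lin k\<close> centred at \<open>v\<close>.\<close>

locale chart =
  fixes v :: "complex ^ 3" and i j k :: 3
  assumes idx: "UNIV = {i, j, k}" "i \<noteq> j" "i \<noteq> k" "j \<noteq> k" and vi: "v $ i = 1"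
begin

definition lin :: "3 \<Rightarrow> poly3" where "lin l = coord l - monom3 (v $ l) 0 0 0 * coord i"

lemma eval3_lin: "eval3 (lin l) u = u $ l - v $ l * u $ i"
  by (simp add: lin_def eval3_eq_ev ev_diff ev_mult ev_coord ev_monom3 ring_map_id)

lemma ev_lin: "ring_map h \<Longrightarrow> ev h (lin l) a = a $ l - h (v $ l) * a $ i"
  by (simp add: lin_def ev_diff ev_mult ev_coord ev_monom3)

lemma homogeneous_lin: "homogeneous 1 (lin l)"
  unfolding lin_def by (intro homogeneous_diff homogeneous_const_mult homogeneous_coord)

text \<open>The expansion of a form at \<open>v\<close> to first order, with forms as cofactors so
  that degrees stay under control. For \<open>n = 0\<close> the subtraction \<open>n - 1\<close>
  gives 0, and the last clause forces the cofactors to vanish.\<close>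

definition expands :: "nat \<Rightarrow> poly3 \<Rightarrow> bool" where
  "expands n G \<longleftrightarrow> homogeneous n G \<and>
     (\<exists>c A B. G = monom3 c 0 0 0 * coord i ^ n + lin j * A + lin k * B \<and>
        homogeneous (n - 1) A \<and> homogeneous (n - 1) B \<and> (n = 0 \<longrightarrow> A = 0 \<and> B = 0))"

lemma expands_add:
  assumes "expands n G" "expands n H" shows "expands n (G + H)"
proof -
  obtain c A B c' A' B' where *:
    "G = monom3 c 0 0 0 * coord i ^ n + lin j * A + lin k * B" "homogeneous (n - 1) A"
    "homogeneous (n - 1) B" "n = 0 \<longrightarrow> A = 0 \<and> B = 0"
    "H = monom3 c' 0 0 0 * coord i ^ n + lin j * A' + lin k * B'" "homogeneous (n - 1) A'"
    "homogeneous (n - 1) B'" "n = 0 \<longrightarrow> A' = 0 \<and> B' = 0"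
    using assms unfolding expands_def by blast
  have "monom3 (c + c') 0 0 0 = monom3 c 0 0 0 + monom3 c' 0 0 0"
    by (simp add: monom3_def add_monom)
  then have "G + H = monom3 (c + c') 0 0 0 * coord i ^ n + lin j * (A + A') + lin k * (B + B')"
    unfolding * by (simp add: algebra_simps)
  moreover have "homogeneous n (G + H)" using assms by (simp add: expands_def homogeneous_add)
  ultimately show ?thesis
    unfolding expands_def using homogeneous_add * by (metis add.right_neutral)
qed

lemma expands_coord_mult:
  assumes "expands n G" shows "expands (Suc n) (coord l * G)"
proof -
  obtain c A B where G: "homogeneous n G"
    "G = monom3 c 0 0 0 * coord i ^ n + lin j * A + lin k * B" "homogeneous (n - 1) A"
    "homogeneous (n - 1) B" "n = 0 \<longrightarrow> A = 0 \<and> B = 0"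
    using assms unfolding expands_def by blast
  \<comment> \<open>\<open>\<delta>\<close> writes each coordinate as \<open>v $ l\<close> times
    \<open>coord i\<close> plus a combination of \<open>lin j\<close> and \<open>lin k\<close>; for
    \<open>l = i\<close> this works because \<open>v $ i = 1\<close>.\<close>
  define \<delta> where "\<delta> = (\<lambda>m. if l = m then 1 else (0 :: poly3))"
  have "l \<in> {i, j, k}" using idx(1) by blast
  moreover have "monom3 (v $ i) 0 0 0 = 1"
    by (simp add: vi monom3_def monom_0 one_pCons)
  ultimately have coord: "coord l = monom3 (v $ l) 0 0 0 * coord i + \<delta> j * lin j + \<delta> k * lin k"
    using idx(2-4) by (auto simp: \<delta>_def lin_def)
  define A' B' where "A' = monom3 (v $ l) 0 0 0 * coord i * A + \<delta> j * G"
    and "B' = monom3 (v $ l) 0 0 0 * coord i * B + \<delta> k * G"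
  have "coord l * G = monom3 (v $ l) 0 0 0 * coord i * G + lin j * (\<delta> j * G) + lin k * (\<delta> k * G)"
    by (subst coord) (simp add: algebra_simps)
  also have "monom3 (v $ l) 0 0 0 * coord i * G = monom3 (v $ l * c) 0 0 0 * coord i ^ Suc n +
      lin j * (monom3 (v $ l) 0 0 0 * coord i * A) + lin k * (monom3 (v $ l) 0 0 0 * coord i * B)"
    using monom3_mult[of "v $ l" 0 0 0 c 0 0 0] by (subst G(2)) (simp add: algebra_simps)
  finally have eq: "coord l * G = monom3 (v $ l * c) 0 0 0 * coord i ^ Suc n + lin j * A' + lin k * B'"
    by (simp add: A'_def B'_def algebra_simps)
  have hom: "homogeneous n (monom3 (v $ l) 0 0 0 * coord i * C)"
    if "homogeneous (n - 1) C" "n = 0 \<longrightarrow> C = 0" for C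
  proof (cases n)
    case (Suc m)
    then show ?thesis
      using homogeneous_mult[OF homogeneous_const_mult[OF homogeneous_coord] that(1)] by simp
  qed (use that in simp)
  have "homogeneous n (\<delta> m * G)" for m using G(1) by (simp add: \<delta>_def)
  then have "homogeneous n A'" "homogeneous n B'"
    unfolding A'_def B'_def using hom G by (auto intro!: homogeneous_add)
  moreover have "homogeneous (Suc n) (coord l * G)"
    using homogeneous_mult[OF homogeneous_coord G(1)] by simp
  ultimately show ?thesis unfolding expands_def using eq by auto
qed

lemma expands_coord_power_mult: "expands n G \<Longrightarrow> expands (m + n) (coord l ^ m * G)"
  by (induction m) (auto simp: mult.assoc dest: expands_coord_mult)

lemma homogeneous_expands: "homogeneous n G \<Longrightarrow> expands n G"
proof (induction rule: form_induct)
  case zero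
  have "0 = monom3 0 0 0 0 * coord i ^ n + lin j * 0 + lin k * 0" by (simp add: monom3_def)
  then show ?case unfolding expands_def by (metis homogeneous_0)
next
  case (add G H)
  then show ?case by (rule expands_add)
next
  case (monom3 c i' j' k')
  have "monom3 c 0 0 0 = monom3 c 0 0 0 * coord i ^ 0 + lin j * 0 + lin k * 0" by simp
  then have "expands 0 (monom3 c 0 0 0)"
    unfolding expands_def by (metis homogeneous_0 homogeneous_const)
  then have "expands (k' + (j' + (i' + 0))) (coord 3 ^ k' * (coord 2 ^ j' * (coord 1 ^ i' * monom3 c 0 0 0)))"
    by (intro expands_coord_power_mult)
  moreover have "k' + (j' + (i' + 0)) = n" using monom3 by simp
  moreover have "coord 3 ^ k' * (coord 2 ^ j' * (coord 1 ^ i' * monom3 c 0 0 0)) = monom3 c i' j' k'"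
    by (subst monom3_eq_coord[of c i']) (simp add: algebra_simps)
  ultimately show ?case by simp
qed

lemma vanishing_form_expansion:
  assumes "homogeneous n G" "eval3 G v = 0"
  obtains A B where "G = lin j * A + lin k * B" "homogeneous (n - 1) A" "homogeneous (n - 1) B"
    "n = 0 \<Longrightarrow> A = 0 \<and> B = 0"
proof -
  obtain c A B where *: "G = monom3 c 0 0 0 * coord i ^ n + lin j * A + lin k * B"
    "homogeneous (n - 1) A" "homogeneous (n - 1) B" "n = 0 \<longrightarrow> A = 0 \<and> B = 0"
    using homogeneous_expands[OF assms(1)] unfolding expands_def by blast
  have "eval3 G v = c"
    unfolding *(1)
    by (simp add: eval3_eq_ev ev_add ev_mult ev_power ev_coord ev_lin ev_monom3 ring_map_id vi)
  then have "monom3 c 0 0 0 = 0" using assms(2) by (simp add: monom3_def)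
  then have "G = lin j * A + lin k * B" using *(1) by simp
  then show ?thesis using that * by blast
qed

end

section \<open>Orders along formal arcs\<close>

lemma fps_nth_0_ev: "fps_nth (ev fps_const F a) 0 = eval3 F (\<chi> i. fps_nth (a $ i) 0)"
  using ev_compose[OF ring_map_fps_nth_0 ring_map_fps_const, of F a] by (simp add: eval3_eq_ev)

lemma fps_X_dvd_iff: "fps_X dvd (f :: complex fps) \<longleftrightarrow> fps_nth f 0 = 0"
  using fps_X_power_dvd_iff[of 1 f] by simp

text \<open>The order of a rational function along the formal arc \<open>a\<close> is at least \<open>n\<close>.\<close>

definition vanishes_along :: "complex fps ^ 3 \<Rightarrow> nat \<Rightarrow> poly3 fract \<Rightarrow> bool" where
  "vanishes_along a n g \<longleftrightarrow> (\<exists>G H. g = Fract G H \<and> fps_nth (ev fps_const H a) 0 \<noteq> 0 \<and>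
     fps_X ^ n dvd ev fps_const G a)"

lemma nonzero_if_ev: "fps_nth (ev fps_const H a) 0 \<noteq> 0 \<Longrightarrow> H \<noteq> 0"
  by (auto simp: ev_0 ring_map_fps_const)

lemma dvd_mult_unit_fps:
  fixes f u :: "complex fps"
  assumes "g dvd f * u" "fps_nth u 0 \<noteq> 0"
  shows "g dvd f"
proof -
  have "f = f * u * inverse u" using inverse_mult_eq_1'[OF assms(2)] by (simp add: mult.assoc)
  then show ?thesis using assms(1) by (metis dvd_mult2)
qed

text \<open>Cross-multiplying two representations compares numerators up to power series with
  nonzero constant term, which are units; so the order is independent of the fraction
  chosen.\<close>

lemma vanishes_along_Fract:
  assumes "fps_nth (ev fps_const H a) 0 \<noteq> 0"
  shows "vanishes_along a n (Fract G H) \<longleftrightarrow> fps_X ^ n dvd ev fps_const G a"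
proof
  assume "vanishes_along a n (Fract G H)"
  then obtain G' H' where *: "Fract G H = Fract G' H'" "fps_nth (ev fps_const H' a) 0 \<noteq> 0"
    "fps_X ^ n dvd ev fps_const G' a" by (auto simp: vanishes_along_def)
  then have "G * H' = G' * H" using assms by (simp add: eq_fract nonzero_if_ev)
  then have "ev fps_const G a * ev fps_const H' a = ev fps_const G' a * ev fps_const H a"
    by (metis ev_mult ring_map_fps_const)
  then have "fps_X ^ n dvd ev fps_const G a * ev fps_const H' a" using *(3) by simp
  then show "fps_X ^ n dvd ev fps_const G a" using *(2) by (rule dvd_mult_unit_fps)
qed (use assms in \<open>auto simp: vanishes_along_def\<close>)

lemma vanishes_along_add:
  assumes "vanishes_along a n g" "vanishes_along a n h"
  shows "vanishes_along a n (g + h)"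
proof -
  obtain G H G' H' where *: "g = Fract G H" "fps_nth (ev fps_const H a) 0 \<noteq> 0"
    "fps_X ^ n dvd ev fps_const G a" "h = Fract G' H'" "fps_nth (ev fps_const H' a) 0 \<noteq> 0"
    "fps_X ^ n dvd ev fps_const G' a"
    using assms by (auto simp: vanishes_along_def)
  have "g + h = Fract (G * H' + G' * H) (H * H')" using * by (simp add: nonzero_if_ev)
  moreover have "fps_nth (ev fps_const (H * H') a) 0 \<noteq> 0"
    using * by (simp add: ev_mult ring_map_fps_const)
  moreover have "fps_X ^ n dvd ev fps_const (G * H' + G' * H) a"
    using * by (simp add: ev_add ev_mult ring_map_fps_const)
  ultimately show ?thesis unfolding vanishes_along_def by blast
qed

lemma vanishes_along_0: "vanishes_along a n 0"
  unfolding vanishes_along_def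
  by (rule exI[of _ 0], rule exI[of _ 1]) (simp add: ev_0 ev_1 ring_map_fps_const Zero_fract_def)

lemma vanishes_along_sum:
  "(\<And>x. x \<in> S \<Longrightarrow> vanishes_along a n (f x)) \<Longrightarrow> vanishes_along a n (sum f S)"
  by (induction S rule: infinite_finite_induct) (auto intro: vanishes_along_0 vanishes_along_add)

lemma vanishes_along_mult:
  assumes "vanishes_along a m g" "vanishes_along a n h"
  shows "vanishes_along a (m + n) (g * h)"
proof -
  obtain G H G' H' where *: "g = Fract G H" "fps_nth (ev fps_const H a) 0 \<noteq> 0"
    "fps_X ^ m dvd ev fps_const G a" "h = Fract G' H'" "fps_nth (ev fps_const H' a) 0 \<noteq> 0"
    "fps_X ^ n dvd ev fps_const G' a"
    using assms by (auto simp: vanishes_along_def)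
  have "g * h = Fract (G * G') (H * H')" using * by simp
  moreover have "fps_nth (ev fps_const (H * H') a) 0 \<noteq> 0"
    using * by (simp add: ev_mult ring_map_fps_const)
  moreover have "fps_X ^ (m + n) dvd ev fps_const (G * G') a"
    using * by (simp add: ev_mult ring_map_fps_const power_add mult_dvd_mono)
  ultimately show ?thesis unfolding vanishes_along_def by blast
qed

text \<open>A function vanishing at \<open>p\<close> pulls back to a multiple of \<open>X\<close>,
  and orders add in products. The arc is any one starting at \<open>p\<close>: besides branches,
  straight lines through \<open>p\<close> are used for the tangent.\<close>

lemma maximal_ideal_power_vanishes_along:
  assumes base: "(\<chi> i. fps_nth (a $ i) 0) \<noteq> 0" "(\<chi> i. fps_nth (a $ i) 0) \<in> line_of p"
  shows "u \<in> maximal_ideal_power p n \<Longrightarrow> vanishes_along a n u"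
proof (induction n arbitrary: u)
  case 0
  then obtain G H d where *: "u = Fract G H" "homogeneous d H" "\<not> vanishes_at H p"
    by (auto simp: local_ring_def)
  then show ?case
    by (auto simp: vanishes_at_iff[OF _ base] vanishes_along_Fract fps_nth_0_ev)
next
  case (Suc n)
  then obtain m f g where u: "u = (\<Sum>i<(m::nat). f i * g i)"
    and fg: "\<And>i. i < m \<Longrightarrow> f i \<in> maximal_ideal p" "\<And>i. i < m \<Longrightarrow> g i \<in> maximal_ideal_power p n"
    by auto
  have "vanishes_along a 1 (f i)" if im: "i < m" for i
  proof -
    obtain G H d where *: "f i = Fract G H" "homogeneous d G" "homogeneous d H"
      "\<not> vanishes_at H p" "vanishes_at G p"
      using fg(1)[OF im] by (auto simp: maximal_ideal_def)
    then show ?thesis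
      by (auto simp: vanishes_at_iff[OF _ base] vanishes_along_Fract fps_nth_0_ev
          fps_X_dvd_iff)
  qed
  then have "vanishes_along a (1 + n) (f i * g i)" if "i < m" for i
    using that fg(2) Suc.IH by (intro vanishes_along_mult) auto
  then show ?case unfolding u by (intro vanishes_along_sum) simp
qed

lemma curve_ideal_vanishes_along:
  assumes base: "(\<chi> i. fps_nth (a $ i) 0) \<noteq> 0" "(\<chi> i. fps_nth (a $ i) 0) \<in> line_of p"
    and "ev fps_const F a = 0" and "w \<in> curve_ideal F p"
  shows "vanishes_along a n w"
proof -
  obtain G H d where *: "w = Fract G H" "homogeneous d H" "\<not> vanishes_at H p" "F dvd G"
    using assms(4) by (auto simp: curve_ideal_def)
  then show ?thesis using assms(3)
    by (auto simp: vanishes_at_iff[OF _ base] vanishes_along_Fract fps_nth_0_ev ev_mult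
        ring_map_fps_const)
qed

section \<open>Arithmetic in the local ring\<close>

lemma vanishes_at_mult_iff:
  assumes "homogeneous m G" "homogeneous n H"
  shows "vanishes_at (G * H) p \<longleftrightarrow> vanishes_at G p \<or> vanishes_at H p"
proof -
  obtain v where v: "v \<noteq> 0" "v \<in> line_of p" by (rule line_of_point)
  show ?thesis
    using assms by (simp add: vanishes_at_iff[OF _ v] homogeneous_mult eval3_mult
        vanishes_at_iff[OF homogeneous_mult[OF assms] v])
qed

lemma not_vanishes_at_nonzero: "\<not> vanishes_at H p \<Longrightarrow> H \<noteq> 0"
  by (auto simp: vanishes_at_def eval3_def)

lemma local_ringI:
  "homogeneous d G \<Longrightarrow> homogeneous d H \<Longrightarrow> \<not> vanishes_at H p \<Longrightarrow> Fract G H \<in> local_ring p"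
  unfolding local_ring_def by blast

lemma maximal_idealI:
  "homogeneous d G \<Longrightarrow> homogeneous d H \<Longrightarrow> \<not> vanishes_at H p \<Longrightarrow> vanishes_at G p \<Longrightarrow>
    Fract G H \<in> maximal_ideal p"
  unfolding maximal_ideal_def by blast

lemma curve_idealI:
  "homogeneous d G \<Longrightarrow> homogeneous d H \<Longrightarrow> \<not> vanishes_at H p \<Longrightarrow> F dvd G \<Longrightarrow>
    Fract G H \<in> curve_ideal F p"
  unfolding curve_ideal_def by blast

lemma curve_ideal_add:
  assumes "w \<in> curve_ideal F p" "w' \<in> curve_ideal F p"
  shows "w + w' \<in> curve_ideal F p"
proof -
  obtain G H d G' H' d' where *: "w = Fract G H" "homogeneous d G" "homogeneous d H"
    "\<not> vanishes_at H p" "F dvd G" "w' = Fract G' H'" "homogeneous d' G'" "homogeneous d' H'"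
    "\<not> vanishes_at H' p" "F dvd G'"
    using assms by (auto simp: curve_ideal_def)
  have "w + w' = Fract (G * H' + G' * H) (H * H')" using * by (simp add: not_vanishes_at_nonzero)
  moreover have "homogeneous (d + d') (G * H' + G' * H)"
    using homogeneous_mult[OF *(2) *(8)] homogeneous_mult[OF *(7) *(3)]
    by (simp add: homogeneous_add add.commute)
  moreover have "\<not> vanishes_at (H * H') p" using * by (simp add: vanishes_at_mult_iff)
  moreover have "F dvd G * H' + G' * H" using * by simp
  ultimately show ?thesis
    using curve_idealI[OF _ homogeneous_mult[OF *(3) *(8)]] by simp
qed

lemma curve_ideal_mult:
  assumes "w \<in> curve_ideal F p" "g \<in> maximal_ideal p"
  shows "g * w \<in> curve_ideal F p"
proof -
  obtain G H d G' H' d' where *: "w = Fract G H" "homogeneous d G" "homogeneous d H"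
    "\<not> vanishes_at H p" "F dvd G" "g = Fract G' H'" "homogeneous d' G'" "homogeneous d' H'"
    "\<not> vanishes_at H' p"
    using assms by (auto simp: curve_ideal_def maximal_ideal_def)
  have "g * w = Fract (G' * G) (H' * H)" using * by simp
  moreover have "\<not> vanishes_at (H' * H) p" using * by (simp add: vanishes_at_mult_iff)
  moreover have "F dvd G' * G" using * by simp
  ultimately show ?thesis
    using curve_idealI[OF homogeneous_mult[OF *(7) *(2)] homogeneous_mult[OF *(8) *(3)]] by simp
qed

text \<open>A formal parametrisation \<open>a\<close> of the curve at \<open>p\<close> with local parameter \<open>fps_X\<close>.\<close>

locale branch = chart v i j k for v :: "complex ^ 3" and i j k :: 3 +
  fixes F :: poly3 and p :: proj_plane and a :: "complex fps ^ 3"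
  assumes ns: "nonsingular_plane_quartic F"
    and v_p: "v \<in> line_of p"
    and grad: "eval3 (partial k F) v \<noteq> 0"
    and a: "a $ i = 1" "a $ j = fps_const (v $ j) + fps_X" "fps_nth (a $ k) 0 = v $ k"
    and F_a: "ev fps_const F a = 0"
begin

lemma a_base: "(\<chi> l. fps_nth (a $ l) 0) = v"
proof -
  have "fps_nth (a $ l) 0 = v $ l" for l
  proof -
    have "l \<in> {i, j, k}" using idx(1) by blast
    then show ?thesis using a vi by auto
  qed
  then show ?thesis by (simp add: vec_eq_iff)
qed

lemma v_nz: "v \<noteq> 0"
  using vi by (metis zero_index zero_neq_one)

lemmas vanishes_at_p = vanishes_at_iff[OF _ v_nz v_p]

lemma fps_nth_0_ev_a: "fps_nth (ev fps_const G a) 0 = eval3 G v"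
  by (simp add: fps_nth_0_ev a_base)

lemma F_v: "eval3 F v = 0"
  using fps_nth_0_ev_a[of F] F_a by simp

lemma dvd_of_ev_eq_0: "homogeneous n G \<Longrightarrow> ev fps_const G a = 0 \<Longrightarrow> F dvd G"
  using branch_determines_component[OF ns _ F_a _ a(1,2)] by blast

lemma ev_lin_j: "ev fps_const (lin j) a = fps_X"
  using a by (simp add: ev_lin ring_map_fps_const)

lemma coord_i_p: "\<not> vanishes_at (coord i) p"
  by (simp add: vanishes_at_p[OF homogeneous_coord] eval3_coord vi)

lemma parameter_in_maximal_ideal: "Fract (lin j) (coord i) \<in> maximal_ideal p"
  by (rule maximal_idealI[OF homogeneous_lin homogeneous_coord coord_i_p])
    (simp add: vanishes_at_p[OF homogeneous_lin] eval3_lin vi)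

text \<open>
  Since \<open>F = lin j * C + lin k * E\<close> with \<open>E\<close> a unit at \<open>p\<close>, the second coordinate is a multiple of
  the first one modulo \<open>F\<close>.
\<close>

lemma divide_by_parameter:
  assumes G: "homogeneous d G" "eval3 G v = 0" and H: "homogeneous d H" "eval3 H v \<noteq> 0"
  obtains G' H' d' w where "Fract G H = Fract (lin j) (coord i) * Fract G' H' + w"
    "homogeneous d' G'" "homogeneous d' H'" "eval3 H' v \<noteq> 0" "w \<in> curve_ideal F p"
proof -
  have F4: "homogeneous 4 F" by (rule nonsingular_homogeneous[OF ns])
  obtain A B where AB: "G = lin j * A + lin k * B" "homogeneous (d - 1) A" "homogeneous (d - 1) B"
    "d = 0 \<Longrightarrow> A = 0 \<and> B = 0"
    using vanishing_form_expansion[OF G] by metis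
  obtain C E where "F = lin j * C + lin k * E" "homogeneous (4 - 1) C" "homogeneous (4 - 1) E"
    using vanishing_form_expansion[OF F4 F_v] by metis
  then have CE: "F = lin j * C + lin k * E" "homogeneous 3 C" "homogeneous 3 E" by simp_all
  have E: "eval3 E v \<noteq> 0"
  proof -
    \<comment> \<open>Along \<open>v + t axis k 1\<close> the form \<open>lin j\<close> is 0 and
      \<open>lin k\<close> is \<open>t\<close>, so the derivative of \<open>F\<close> in direction
      \<open>k\<close> at \<open>v\<close> is \<open>E(v)\<close>.\<close>
    have "line_poly (lin l) v (axis k 1) = [:0, if l = k then 1 else 0:]" if "l \<noteq> i" for l
    proof -
      have "poly (line_poly (lin l) v (axis k 1)) t = poly [:0, if l = k then 1 else 0:] t" for t
        using idx vi by (simp add: poly_line_poly eval3_lin axis_def)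
      then show ?thesis by (simp add: poly_eq_poly_eq_iff[symmetric] fun_eq_iff)
    qed
    then have "line_poly F v (axis k 1) = [:0, 1:] * line_poly E v (axis k 1)"
      using idx by (simp add: CE(1) line_poly_def ev_add ev_mult ring_map_pCons)
    then have "coeff (line_poly F v (axis k 1)) 1 = coeff (line_poly E v (axis k 1)) 0" by simp
    then have "eval3 (partial k F) v = eval3 E v" by (simp only: partial_axis coeff_line_poly_0)
    then show ?thesis using grad by simp
  qed
  \<comment> \<open>Multiply \<open>G\<close> by \<open>E\<close> and replace
    \<open>lin k * E\<close> by \<open>F - lin j * C\<close>: what remains is
    \<open>lin j * T\<close> plus a multiple of \<open>F\<close>.\<close>
  define T where "T = E * A - C * B"
  have nz: "E \<noteq> 0" "H \<noteq> 0" "coord i \<noteq> 0"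
    using E H(2) coord_i_p by (auto simp: eval3_def not_vanishes_at_nonzero)
  have "E * G = lin j * T + B * F"
    by (simp add: AB(1) CE(1) T_def algebra_simps)
  then have "Fract G H = Fract (lin j * T + B * F) (E * H)"
    using nz mult_fract_cancel[of E G H] by simp
  also have "\<dots> = Fract (lin j * T) (E * H) + Fract (B * F) (E * H)"
    using nz by (simp add: eq_fract algebra_simps)
  also have "Fract (lin j * T) (E * H) = Fract (lin j) (coord i) * Fract (coord i * T) (E * H)"
    using nz by (simp add: eq_fract algebra_simps)
  finally have eq: "Fract G H = Fract (lin j) (coord i) * Fract (coord i * T) (E * H) + Fract (B * F) (E * H)" .
  have EH: "homogeneous (3 + d) (E * H)" "eval3 (E * H) v \<noteq> 0"
    using CE H E by (simp_all add: homogeneous_mult eval3_mult)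
  have T: "homogeneous (3 + d) (coord i * T)" "homogeneous (3 + d) (B * F)"
  proof -
    show "homogeneous (3 + d) (coord i * T)"
    proof (cases d)
      case 0
      then show ?thesis using AB by (simp add: T_def)
    next
      case (Suc m)
      then have "homogeneous (3 + m) T"
        unfolding T_def using AB CE by (intro homogeneous_diff homogeneous_mult) simp_all
      then show ?thesis using homogeneous_mult[OF homogeneous_coord] Suc by fastforce
    qed
    show "homogeneous (3 + d) (B * F)"
    proof (cases d)
      case 0
      then show ?thesis using AB by simp
    next
      case (Suc m)
      then have "homogeneous (m + 4) (B * F)" using AB F4 by (intro homogeneous_mult) simp_all
      then show ?thesis using Suc by (simp add: add.commute eval_nat_numeral)
    qed
  qed
  have "Fract (B * F) (E * H) \<in> curve_ideal F p"
    using EH by (intro curve_idealI[OF T(2) EH(1)]) (simp_all add: vanishes_at_p[OF EH(1)])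
  then show ?thesis using that eq T EH by blast
qed

text \<open>Divisibility by \<open>X\<close> means vanishing at \<open>v\<close>, so the parameter
  splits off modulo the curve. It pulls back to \<open>X\<close> and the error term to 0, so the
  cofactor loses exactly one power of \<open>X\<close> and the induction applies to it.\<close>

lemma germ_in_power_if_dvd:
  assumes "homogeneous d G" "homogeneous d H" "eval3 H v \<noteq> 0" "fps_X ^ n dvd ev fps_const G a"
  shows "germ_in_power F p n (Fract G H)"
  using assms
proof (induction n arbitrary: G H d)
  case 0
  have "0 \<in> curve_ideal F p"
    unfolding Zero_fract_def
    by (rule curve_idealI[OF homogeneous_0 homogeneous_1]) (simp_all add: vanishes_at_p[OF homogeneous_1] eval3_def)
  moreover have "Fract G H \<in> local_ring p"
    using 0 by (intro local_ringI[of d]) (simp_all add: vanishes_at_p[of d])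
  ultimately show ?case unfolding germ_in_power_def by force
next
  case (Suc n)
  have "fps_nth (ev fps_const G a) 0 = 0" using Suc.prems(4) unfolding fps_X_power_dvd_iff by simp
  then have "eval3 G v = 0" by (simp add: fps_nth_0_ev_a)
  then obtain G' H' d' w where *: "Fract G H = Fract (lin j) (coord i) * Fract G' H' + w"
    "homogeneous d' G'" "homogeneous d' H'" "eval3 H' v \<noteq> 0" "w \<in> curve_ideal F p"
    using divide_by_parameter Suc.prems by metis
  have base: "(\<chi> l. fps_nth (a $ l) 0) \<noteq> 0" "(\<chi> l. fps_nth (a $ l) 0) \<in> line_of p"
    using a_base v_nz v_p by simp_all
  have "vanishes_along a (Suc n) (Fract G H)"
    using Suc.prems by (simp add: vanishes_along_Fract fps_nth_0_ev_a del: power_Suc)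
  moreover have "vanishes_along a (Suc n) (- w)"
  proof -
    obtain G1 H1 d1 where w: "w = Fract G1 H1" "homogeneous d1 H1" "\<not> vanishes_at H1 p"
      using *(5) by (auto simp: curve_ideal_def)
    then have "fps_nth (ev fps_const H1 a) 0 \<noteq> 0" by (simp add: fps_nth_0_ev_a vanishes_at_p[of d1])
    then show ?thesis
      using curve_ideal_vanishes_along[OF base F_a *(5), of "Suc n"]
      by (simp add: w(1) vanishes_along_Fract ev_uminus ring_map_fps_const del: power_Suc)
  qed
  ultimately have "vanishes_along a (Suc n) (Fract G H + - w)" by (rule vanishes_along_add)
  also have "Fract G H + - w = Fract (lin j * G') (coord i * H')" using *(1) by simp
  finally have "fps_X ^ Suc n dvd ev fps_const (lin j * G') a"
    using *(4) by (subst (asm) vanishes_along_Fract)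
      (simp_all add: fps_nth_0_ev_a eval3_mult eval3_coord vi)
  then have "fps_X ^ n dvd ev fps_const G' a"
    by (simp add: ev_mult ring_map_fps_const ev_lin_j)
  then have "germ_in_power F p n (Fract G' H')" using Suc.IH * by blast
  then obtain u w' where uw: "u \<in> maximal_ideal_power p n" "w' \<in> curve_ideal F p" "Fract G' H' = u + w'"
    by (auto simp: germ_in_power_def)
  have "Fract (lin j) (coord i) * u \<in> maximal_ideal_power p (Suc n)"
    unfolding maximal_ideal_power.simps using parameter_in_maximal_ideal uw(1)
    by (intro CollectI exI[of _ "1::nat"] exI[of _ "\<lambda>_. Fract (lin j) (coord i)"] exI[of _ "\<lambda>_. u"]) simp
  moreover have "Fract (lin j) (coord i) * w' + w \<in> curve_ideal F p"
    by (intro curve_ideal_add curve_ideal_mult uw * parameter_in_maximal_ideal)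
  moreover have "Fract G H = Fract (lin j) (coord i) * u + (Fract (lin j) (coord i) * w' + w)"
    unfolding *(1) uw(3) by (simp add: algebra_simps)
  ultimately show ?case unfolding germ_in_power_def by blast
qed

lemma dvd_if_germ_in_power:
  assumes "eval3 H v \<noteq> 0" "germ_in_power F p n (Fract G H)"
  shows "fps_X ^ n dvd ev fps_const G a"
proof -
  have base: "(\<chi> l. fps_nth (a $ l) 0) \<noteq> 0" "(\<chi> l. fps_nth (a $ l) 0) \<in> line_of p"
    using a_base v_nz v_p by simp_all
  obtain u w where uw: "u \<in> maximal_ideal_power p n" "w \<in> curve_ideal F p" "Fract G H = u + w"
    using assms(2) by (auto simp: germ_in_power_def)
  have "vanishes_along a n (Fract G H)"
    unfolding uw(3)
    by (intro vanishes_along_add maximal_ideal_power_vanishes_along[OF base uw(1)]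
        curve_ideal_vanishes_along[OF base F_a uw(2)])
  then show ?thesis using assms(1) by (simp add: vanishes_along_Fract fps_nth_0_ev_a)
qed

lemma fps_X_power_dvd_iff_subdegree:
  fixes f :: "complex fps"
  assumes "f \<noteq> 0"
  shows "fps_X ^ n dvd f \<longleftrightarrow> n \<le> subdegree f"
  unfolding fps_X_power_dvd_iff using assms
  by (metis nth_less_subdegree_zero nth_subdegree_nonzero less_le_trans not_le)

text \<open>The admissible exponents are exactly those up to the \<open>subdegree\<close>, so the
  greatest one exists. A power of \<open>coord i\<close> is the denominator for all of them.\<close>

lemma intersection_mult_eq:
  assumes G: "homogeneous d G" "\<not> F dvd G"
  shows "intersection_mult F p G = subdegree (ev fps_const G a)"
proof -
  have nz: "ev fps_const G a \<noteq> 0" using dvd_of_ev_eq_0 G by blast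
  have "(\<exists>H d. homogeneous d G \<and> homogeneous d H \<and> \<not> vanishes_at H p \<and>
      germ_in_power F p n (Fract G H)) \<longleftrightarrow> n \<le> subdegree (ev fps_const G a)" for n
  proof
    assume "n \<le> subdegree (ev fps_const G a)"
    then have dvd: "fps_X ^ n dvd ev fps_const G a" using nz by (simp add: fps_X_power_dvd_iff_subdegree)
    have H: "homogeneous d (coord i ^ d)" using homogeneous_power[OF homogeneous_coord, of d] by simp
    have v: "eval3 (coord i ^ d) v \<noteq> 0"
      by (simp add: eval3_eq_ev ev_power ring_map_id ev_coord vi)
    show "\<exists>H d. homogeneous d G \<and> homogeneous d H \<and> \<not> vanishes_at H p \<and>
      germ_in_power F p n (Fract G H)"
      using G(1) H v germ_in_power_if_dvd[OF G(1) H v dvd]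
      by (intro exI[of _ "coord i ^ d"] exI[of _ d]) (simp add: vanishes_at_p[OF H])
  next
    assume "\<exists>H d. homogeneous d G \<and> homogeneous d H \<and> \<not> vanishes_at H p \<and>
      germ_in_power F p n (Fract G H)"
    then have "fps_X ^ n dvd ev fps_const G a"
      using dvd_if_germ_in_power by (auto simp: vanishes_at_p)
    then show "n \<le> subdegree (ev fps_const G a)" using nz by (simp add: fps_X_power_dvd_iff_subdegree)
  qed
  then show ?thesis unfolding intersection_mult_def by (intro Greatest_equality) auto
qed

end

lemma branch_exists:
  assumes ns: "nonsingular_plane_quartic F" and p: "p \<in> curve F"
  obtains v i j k a where "branch v i j k F p a"
proof -
  have F4: "homogeneous 4 F" by (rule nonsingular_homogeneous[OF ns])
  obtain v0 where v0: "v0 \<noteq> 0" "v0 \<in> line_of p" by (rule line_of_point)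
  then obtain i where i: "v0 $ i \<noteq> 0" by (auto simp: vec_eq_iff)
  define v where "v = inverse (v0 $ i) *s v0"
  have vi: "v $ i = 1" using i by (simp add: v_def)
  then have v_nz: "v \<noteq> 0" by (metis zero_index zero_neq_one)
  have v_p: "v \<in> line_of p" unfolding line_of_eq[OF v0] v_def by blast
  have Fv: "eval3 F v = 0" using p by (simp add: curve_def vanishes_at_iff[OF F4 v_nz v_p])
  obtain j0 k0 where jk: "i \<noteq> j0" "i \<noteq> k0" "j0 \<noteq> k0" "UNIV = {i, j0, k0}" by (rule other_indices)
  \<comment> \<open>As \<open>v $ i = 1\<close>, Euler's relation expresses the derivative in
    direction \<open>i\<close> by the other two, so one of these is nonzero. It becomes direction
    \<open>k\<close>, the coordinate to solve for.\<close>
  have euler: "eval3 (partial i F) v + eval3 (partial j0 F) v * v $ j0 + eval3 (partial k0 F) v * v $ k0 = 0"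
    using euler_zero[OF F4 Fv] unfolding jk(4) using jk(1-3) vi by (simp add: add.assoc)
  have "eval3 (partial j0 F) v \<noteq> 0 \<or> eval3 (partial k0 F) v \<noteq> 0"
  proof (rule ccontr)
    assume *: "\<not> ?thesis"
    then have "eval3 (partial i F) v = 0" using euler by simp
    moreover obtain l where "eval3 (partial l F) v \<noteq> 0" using nonsingular_gradient[OF ns v_nz Fv] .
    moreover have "l \<in> {i, j0, k0}" using jk(4) by blast
    ultimately show False using * by auto
  qed
  then obtain j k where idx: "UNIV = {i, j, k}" "i \<noteq> j" "i \<noteq> k" "j \<noteq> k" and grad: "eval3 (partial k F) v \<noteq> 0"
  proof
    assume "eval3 (partial j0 F) v \<noteq> 0"
    then show ?thesis using jk by (intro that[of k0 j0]) auto
  next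
    assume "eval3 (partial k0 F) v \<noteq> 0"
    then show ?thesis using jk by (intro that[of j0 k0]) auto
  qed
  \<comment> \<open>Entry \<open>j\<close> carries the parameter and entry \<open>k\<close> the
    unknown, so \<open>q\<close> is \<open>F\<close> as a polynomial in one unknown over power
    series.\<close>
  define b :: "complex fps poly ^ 3" where
    "b = (\<chi> l. if l = i then 1 else if l = j then [:fps_const (v $ j) + fps_X:] else [:fps_const (v $ k), 1:])"
  define q where "q = ev (\<lambda>c. [:fps_const c:]) F b"
  have h: "ring_map (\<lambda>c::complex. [:fps_const c:])" by (simp add: ring_map_def)
  have poly_ev_b: "poly (ev (\<lambda>c. [:fps_const c:]) H b) s = ev fps_const H (\<chi> l. poly (b $ l) s)" for H s
    using ev_compose[OF ring_map_poly_at[of s] h, of H b] by simp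
  have base: "(\<chi> l. fps_nth (poly (b $ l) 0) 0) = v"
  proof -
    have "fps_nth (poly (b $ l) 0) 0 = v $ l" for l
    proof -
      have "l \<in> {i, j, k}" using idx(1) by blast
      then show ?thesis using idx(2-4) vi by (auto simp: b_def)
    qed
    then show ?thesis by (simp add: vec_eq_iff)
  qed
  have at_0: "fps_nth (poly (ev (\<lambda>c. [:fps_const c:]) H b) 0) 0 = eval3 H v" for H
    by (simp add: poly_ev_b fps_nth_0_ev base)
  have pderiv_b: "pderiv (b $ l) = (if l = k then 1 else 0)" for l
  proof -
    have "l \<in> {i, j, k}" using idx(1) by blast
    then show ?thesis using idx(2-4) by (auto simp: b_def pderiv_pCons)
  qed
  have "pderiv q = ev (\<lambda>c. [:fps_const c:]) (partial k F) b"
    unfolding q_def by (subst pderiv_ev[OF h]) (simp_all add: pderiv_b pderiv_pCons if_distrib cong: if_cong)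
  then have "fps_nth (poly (pderiv q) 0) 0 \<noteq> 0" using grad by (simp add: at_0)
  moreover have "fps_nth (poly q 0) 0 = 0" using Fv by (simp add: q_def at_0)
  ultimately obtain s where s: "fps_nth s 0 = 0" "poly q s = 0" using fps_hensel by blast
  define a where "a = (\<chi> l. poly (b $ l) s)"
  have "branch v i j k F p a"
  proof
    show "ev fps_const F a = 0" using s(2) by (simp add: q_def poly_ev_b a_def)
  qed (use idx vi ns v_p grad s in \<open>simp_all add: a_def b_def\<close>)
  then show ?thesis by (rule that)
qed

section \<open>Divisors on the quartic\<close>

lemma intersection_mult_mult:
  assumes ns: "nonsingular_plane_quartic F" and p: "p \<in> curve F"
    and G: "homogeneous d G" "\<not> F dvd G" and H: "homogeneous e H" "\<not> F dvd H"
  shows "intersection_mult F p (G * H) = intersection_mult F p G + intersection_mult F p H"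
proof -
  obtain v i j k a where "branch v i j k F p a" using branch_exists[OF ns p] .
  then interpret branch v i j k F p a .
  have nd: "\<not> F dvd G * H" using nonsingular_dvd_multD[OF ns] G H by blast
  have "ev fps_const G a \<noteq> 0" "ev fps_const H a \<noteq> 0" using dvd_of_ev_eq_0 G H by blast+
  then show ?thesis
    using intersection_mult_eq[OF G] intersection_mult_eq[OF H]
      intersection_mult_eq[OF homogeneous_mult[OF G(1) H(1)] nd]
    by (simp add: ev_mult ring_map_fps_const)
qed

lemma cut_divisor_mult:
  assumes "nonsingular_plane_quartic F"
    and "homogeneous d G" "\<not> F dvd G" "homogeneous e H" "\<not> F dvd H"
  shows "cut_divisor F (G * H) = cut_divisor F G + cut_divisor F H"
  using intersection_mult_mult[OF assms(1) _ assms(2-5)] by (auto simp: cut_divisor_def fun_eq_iff)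

lemma principal_divisorsI:
  "homogeneous d G \<Longrightarrow> homogeneous d H \<Longrightarrow> \<not> F dvd G \<Longrightarrow> \<not> F dvd H \<Longrightarrow>
    cut_divisor F G - cut_divisor F H \<in> principal_divisors F"
  unfolding principal_divisors_def by blast

lemma principal_divisors_add:
  assumes ns: "nonsingular_plane_quartic F"
    and "X \<in> principal_divisors F" "Y \<in> principal_divisors F"
  shows "X + Y \<in> principal_divisors F"
proof -
  obtain G H d G' H' d' where *: "X = cut_divisor F G - cut_divisor F H"
    "homogeneous d G" "homogeneous d H" "\<not> F dvd G" "\<not> F dvd H"
    "Y = cut_divisor F G' - cut_divisor F H'"
    "homogeneous d' G'" "homogeneous d' H'" "\<not> F dvd G'" "\<not> F dvd H'"
    using assms(2,3) unfolding principal_divisors_def by blast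
  have "X + Y = cut_divisor F (G * G') - cut_divisor F (H * H')"
    using cut_divisor_mult[OF ns *(2,4,7,9)] cut_divisor_mult[OF ns *(3,5,8,10)] by (simp add: *(1,6))
  moreover have "\<not> F dvd G * G'" "\<not> F dvd H * H'" using nonsingular_dvd_multD[OF ns] * by blast+
  ultimately show ?thesis
    using principal_divisorsI[OF homogeneous_mult[OF *(2,7)] homogeneous_mult[OF *(3,8)]] by simp
qed

lemma principal_divisors_uminus: "X \<in> principal_divisors F \<Longrightarrow> - X \<in> principal_divisors F"
  unfolding principal_divisors_def by force

lemma principal_divisors_0: "nonsingular_plane_quartic F \<Longrightarrow> 0 \<in> principal_divisors F"
  using principal_divisorsI[OF homogeneous_1 homogeneous_1, of F]
    not_dvd_lower_degree[OF nonsingular_homogeneous homogeneous_1] by simp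

section \<open>The tangent at the hyper-flex\<close>

lemma eval3_tangent_form: "eval3 (tangent_form F v) u = (\<Sum>i\<in>UNIV. eval3 (partial i F) v * u $ i)"
  by (simp add: tangent_form_def eval3_def Let_def sum_3 partial_def algebra_simps)

lemma homogeneous_tangent_form: "homogeneous 1 (tangent_form F v)"
proof -
  have "tangent_form F v = monom3 (eval3 (partial_x F) v) 1 0 0 + monom3 (eval3 (partial_y F) v) 0 1 0 +
      monom3 (eval3 (partial_z F) v) 0 0 1"
    by (simp add: tangent_form_def Let_def monom3_def monom_0 monom_Suc)
  then show ?thesis by (simp add: homogeneous_add homogeneous_monom3)
qed

text \<open>Comparing leading terms along lines through \<open>v\<close> inverts the roles of \<open>F\<close> and its tangent.\<close>

lemma tangent_contact:
  assumes ns: "nonsingular_plane_quartic F" and v: "v \<noteq> 0" "v \<in> line_of p" and p: "p \<in> curve F"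
    and H: "homogeneous e H" "\<not> vanishes_at H p"
    and germ: "germ_in_power F p n (Fract (tangent_form F v) H)" and n: "2 \<le> n"
    and d: "eval3 (tangent_form F v) d = 0" and m: "m < n"
  shows "coeff (line_poly F v d) m = 0"
proof -
  let ?L = "tangent_form F v"
  have F4: "homogeneous 4 F" by (rule nonsingular_homogeneous[OF ns])
  have Fv: "eval3 F v = 0" using p by (simp add: curve_def vanishes_at_iff[OF F4 v])
  have Hv: "eval3 H v \<noteq> 0" using H by (simp add: vanishes_at_iff[OF H(1) v])
  obtain u w where uw: "u \<in> maximal_ideal_power p n" "w \<in> curve_ideal F p" "Fract ?L H = u + w"
    using germ by (auto simp: germ_in_power_def)
  obtain Q K c where w: "w = Fract (F * Q) K" and K: "homogeneous c K" "\<not> vanishes_at K p"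
    using uw(2) by (auto simp: curve_ideal_def elim!: dvdE)
  have Kv: "eval3 K v \<noteq> 0" using K by (simp add: vanishes_at_iff[OF K(1) v])
  have "H \<noteq> 0" "K \<noteq> 0" using H K not_vanishes_at_nonzero by blast+
  moreover have "u = Fract ?L H - Fract (F * Q) K" using uw(3) w by simp
  ultimately have u: "u = Fract (?L * K - F * Q * H) (H * K)" by simp
  \<comment> \<open>Membership of \<open>u\<close> in the \<open>n\<close>-th power of the maximal
    ideal is tested on straight lines through \<open>v\<close>: the numerator has no terms below
    degree \<open>n\<close> along any of them.\<close>
  have key: "coeff (line_poly (?L * K - F * Q * H) v b) l = 0" if "l < n" for b l
  proof -
    define a where "a = (\<chi> i. fps_of_poly [:v $ i, b $ i:])"
    have of_poly: "ring_map (fps_of_poly :: complex poly \<Rightarrow> complex fps)"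
      by (simp add: ring_map_def fps_of_poly_add fps_of_poly_mult)
    have ev_a: "ev fps_const G a = fps_of_poly (line_poly G v b)" for G
      unfolding line_poly_def
      using ev_compose[OF of_poly ring_map_pCons, of G "\<chi> i. [:v $ i, b $ i:]"]
      by (simp add: a_def fps_of_poly_const)
    have base: "(\<chi> i. fps_nth (a $ i) 0) = v" by (simp add: a_def vec_eq_iff)
    have "vanishes_along a n u"
      using maximal_ideal_power_vanishes_along[of a p u n] uw(1) v base by simp
    then have "fps_X ^ n dvd ev fps_const (?L * K - F * Q * H) a"
      unfolding u using Hv Kv by (subst (asm) vanishes_along_Fract) (simp_all add: fps_nth_0_ev base eval3_mult)
    then show ?thesis using that by (simp add: ev_a fps_X_power_dvd_iff)
  qed
  have line: "line_poly (?L * K - F * Q * H) v b =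
      line_poly ?L v b * line_poly K v b - line_poly F v b * (line_poly Q v b * line_poly H v b)" for b
    by (simp add: line_poly_def ev_mult ev_diff ring_map_pCons mult.assoc)
  have L1: "coeff (line_poly ?L v b) 1 = eval3 ?L b" for b
    using degree_line_poly(2)[OF homogeneous_tangent_form] .
  have F1: "coeff (line_poly F v b) 1 = eval3 ?L b" for b
    by (simp only: coeff_line_poly_1 eval3_tangent_form)
  have F0: "coeff (line_poly F v b) 0 = 0" for b by (simp add: coeff_line_poly_0 Fv)
  have "eval3 ?L v = 0" using euler_zero[OF F4 Fv] by (simp only: eval3_tangent_form)
  then have L0: "coeff (line_poly ?L v b) 0 = 0" for b by (simp add: coeff_line_poly_0)
  obtain i where i: "eval3 (partial i F) v \<noteq> 0" using nonsingular_gradient[OF ns v(1) Fv] .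
  \<comment> \<open>A direction transverse to the tangent. There \<open>F\<close> and its tangent
    form have the same nonzero linear coefficient, so the vanishing coefficient 1 of
    \<open>key\<close>, available as \<open>2 \<le> n\<close>, gives
    \<open>K(v) = Q(v) * H(v)\<close> and \<open>Q(v)\<close> is nonzero.\<close>
  define b where "b = (axis i 1 :: complex ^ 3)"
  have Lb: "eval3 ?L b \<noteq> 0"
    using i by (simp add: eval3_tangent_form b_def axis_def if_distrib cong: if_cong)
  have coeff_1: "coeff (f * g) 1 = coeff f 0 * coeff g 1 + coeff f 1 * coeff g 0" for f g :: "complex poly"
    by (simp add: coeff_mult)
  have "eval3 ?L b * eval3 K v = eval3 ?L b * (eval3 Q v * eval3 H v)"
    using key[of 1 b] n unfolding line coeff_diff coeff_1 L0 L1 F0 F1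
    by (simp add: coeff_line_poly_0 coeff_mult)
  then have Qv: "eval3 Q v \<noteq> 0" using Lb Kv by auto
  \<comment> \<open>Along the tangent only \<open>F * Q * H\<close> survives, and \<open>Q\<close>
    and \<open>H\<close> are units at \<open>v\<close>; the order \<open>n\<close> therefore passes
    to \<open>F\<close>.\<close>
  have "line_poly ?L v d = 0"
  proof (rule poly_eqI)
    fix l :: nat
    have "degree (line_poly ?L v d) \<le> 1" by (rule degree_line_poly(1)[OF homogeneous_tangent_form])
    moreover have "l = 0 \<or> l = 1 \<or> 1 < l" by linarith
    ultimately show "coeff (line_poly ?L v d) l = coeff 0 l"
      using L0[of d] L1[of d] d coeff_eq_0[of "line_poly ?L v d" l] by auto
  qed
  then have "coeff (line_poly F v d * (line_poly Q v d * line_poly H v d)) l = 0" if "l < n" for l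
    using key[OF that, of d] by (simp add: line)
  then have "fps_X ^ n dvd fps_of_poly (line_poly F v d) * fps_of_poly (line_poly Q v d * line_poly H v d)"
    by (simp add: fps_X_power_dvd_iff flip: fps_of_poly_mult)
  then have "fps_X ^ n dvd fps_of_poly (line_poly F v d)"
    by (rule dvd_mult_unit_fps) (use Qv Hv in \<open>simp add: coeff_mult coeff_line_poly_0\<close>)
  then show ?thesis using m by (simp add: fps_X_power_dvd_iff)
qed

lemma proportional_points:
  assumes "v \<noteq> 0" "v \<in> line_of p" "d \<noteq> 0" "d \<in> line_of q" and "\<And>i j. v $ i * d $ j = v $ j * d $ i"
  shows "p = q"
proof -
  obtain l where l: "v $ l \<noteq> 0" using assms(1) by (auto simp: vec_eq_iff)
  have "d = (d $ l / v $ l) *s v"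
    using assms(5)[of l] l by (simp add: vec_eq_iff field_simps)
  then have "d \<in> line_of p" unfolding line_of_eq[OF assms(1,2)] by blast
  then have "line_of p = line_of q" using line_of_eq assms(3,4) by metis
  then show ?thesis by (simp add: line_of_inject)
qed

lemma hyperflex_tangent:
  assumes ns: "nonsingular_plane_quartic F" and flex: "hyperflex F p"
  obtains L where "homogeneous 1 L" "L \<noteq> 0" "cut_divisor F L = point_multiple 4 p"
proof -
  obtain v where p: "p \<in> curve F" and v: "v \<in> line_of p" "v \<noteq> 0"
    and four: "intersection_mult F p (tangent_form F v) = 4"
    using flex by (auto simp: hyperflex_def)
  define L where "L = tangent_form F v"
  have F4: "homogeneous 4 F" by (rule nonsingular_homogeneous[OF ns])
  have L: "homogeneous 1 L" unfolding L_def by (rule homogeneous_tangent_form)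
  have Fv: "eval3 F v = 0" using p by (simp add: curve_def vanishes_at_iff[OF F4 v(2,1)])
  obtain i where i: "eval3 (partial i F) v \<noteq> 0" using nonsingular_gradient[OF ns v(2) Fv] .
  have "eval3 L (axis i 1) \<noteq> 0"
    using i by (simp add: L_def eval3_tangent_form axis_def if_distrib cong: if_cong)
  then have L_nz: "L \<noteq> 0" by (auto simp: eval3_def)
  have nd: "\<not> F dvd L" by (rule not_dvd_lower_degree[OF F4 L L_nz]) simp
  \<comment> \<open>The hypothesis gives only the value of a \<open>GREATEST\<close>; going through
    a branch recovers an actual germ in the fourth power.\<close>
  obtain H where H: "homogeneous 1 H" "\<not> vanishes_at H p" and germ: "germ_in_power F p 4 (Fract L H)"
  proof -
    obtain v' i j k a where "branch v' i j k F p a" using branch_exists[OF ns p] .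
    then interpret branch v' i j k F p a .
    have "ev fps_const L a \<noteq> 0" using dvd_of_ev_eq_0 L nd by blast
    moreover have "subdegree (ev fps_const L a) = 4" using intersection_mult_eq[OF L nd] four by (simp add: L_def)
    ultimately have "fps_X ^ 4 dvd ev fps_const L a" by (simp add: fps_X_power_dvd_iff_subdegree)
    then have "germ_in_power F p 4 (Fract L (coord i))"
      by (intro germ_in_power_if_dvd[OF L homogeneous_coord]) (simp_all add: eval3_coord vi)
    then show ?thesis using that homogeneous_coord coord_i_p by blast
  qed
  have L_q: "\<not> vanishes_at L q" if q: "q \<in> curve F" "q \<noteq> p" for q
  proof
    assume Lq: "vanishes_at L q"
    obtain d where d: "d \<noteq> 0" "d \<in> line_of q" by (rule line_of_point)
    have Ld: "eval3 L d = 0" using Lq by (simp add: vanishes_at_iff[OF L d])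
    have Fd: "eval3 F d = 0" using q by (simp add: curve_def vanishes_at_iff[OF F4 d])
    have contact: "coeff (line_poly F v d) m = 0" if "m < 4" for m
      using tangent_contact[OF ns v(2,1) p H germ[unfolded L_def] _ Ld[unfolded L_def] that] by simp
    \<comment> \<open>Coefficients 0 to 3 vanish by the contact at \<open>v\<close>, and coefficient
      4 is the value at the second point \<open>d\<close>; the curve would contain the
      tangent.\<close>
    have "line_poly F v d = 0"
    proof (rule poly_eqI)
      fix m :: nat
      consider "m < 4" | "m = 4" | "m > 4" by linarith
      then show "coeff (line_poly F v d) m = coeff 0 m"
        using contact degree_line_poly[OF F4, of v d] Fd by cases (auto intro!: coeff_eq_0)
    qed
    then have line: "eval3 F (v + t *s d) = 0" for t by (simp flip: poly_line_poly)
    have zero: "eval3 F (\<alpha> *s v + \<beta> *s d) = 0" for \<alpha> \<beta>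
    proof (cases "\<alpha> = 0")
      case True
      then show ?thesis using Fd by (simp add: eval3_scale[OF F4])
    next
      case False
      then have "\<alpha> *s v + \<beta> *s d = \<alpha> *s (v + (\<beta> / \<alpha>) *s d)" by (simp add: vector_add_ldistrib)
      then show ?thesis using line by (simp only: eval3_scale[OF F4]) simp
    qed
    obtain l m where "v $ l * d $ m \<noteq> v $ m * d $ l"
      using proportional_points[OF v(2,1) d] q(2) by blast
    then show False using no_line_in_nonsingular[OF ns _ zero] by blast
  qed
  have "intersection_mult F q L = 0" if q: "q \<in> curve F" "q \<noteq> p" for q
  proof -
    obtain v' i j k a where "branch v' i j k F q a" using branch_exists[OF ns q(1)] .
    then interpret branch v' i j k F q a .
    have "fps_nth (ev fps_const L a) 0 \<noteq> 0"
      using L_q[OF q] by (simp add: fps_nth_0_ev_a vanishes_at_p[OF L])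
    then show ?thesis by (simp add: intersection_mult_eq[OF L nd] subdegree_eq_0)
  qed
  then have "cut_divisor F L = point_multiple 4 p"
    using p four by (auto simp: cut_divisor_def point_multiple_def fun_eq_iff L_def)
  then show ?thesis using that L L_nz by blast
qed

section \<open>Existence of the conic\<close>

lemma underdetermined_system:
  fixes f :: "'j \<Rightarrow> 'i \<Rightarrow> 'a::field"
  assumes "finite J" "finite I" "card J < card I"
  shows "\<exists>c. (\<exists>i\<in>I. c i \<noteq> 0) \<and> (\<forall>j\<in>J. (\<Sum>i\<in>I. c i * f j i) = 0)"
  using assms
proof (induction J arbitrary: I f rule: finite_induct)
  case empty
  then obtain i where "i \<in> I" by fastforce
  then show ?case by (intro exI[of _ "\<lambda>_. 1"]) auto
next
  case (insert j J)
  show ?case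
  proof (cases "\<forall>i\<in>I. f j i = 0")
    case True
    have "card J < card I" using insert by simp
    then show ?thesis using insert.IH[OF insert.prems(1), of f] True by (auto intro: exI)
  next
    case False
    then obtain p where p: "p \<in> I" "f j p \<noteq> 0" by blast
    \<comment> \<open>One step of Gaussian elimination: equation \<open>j\<close> is solved for the
      unknown \<open>p\<close>, and substitution leaves the coefficients
      \<open>f l i - f l p / f j p * f j i\<close>.\<close>
    define I' where "I' = I - {p}"
    have I': "finite I'" "p \<notin> I'" "I = Set.insert p I'" using insert.prems p by (auto simp: I'_def)
    have "card J < card I'" using insert I' by simp
    then obtain c where c: "\<exists>i\<in>I'. c i \<noteq> 0"
      "\<And>l. l \<in> J \<Longrightarrow> (\<Sum>i\<in>I'. c i * (f l i - f l p / f j p * f j i)) = 0"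
      using insert.IH[OF I'(1), of "\<lambda>l i. f l i - f l p / f j p * f j i"] by blast
    define c' where "c' = c(p := - (\<Sum>i\<in>I'. c i * f j i) / f j p)"
    have sum: "(\<Sum>i\<in>I. c' i * g i) = - (\<Sum>i\<in>I'. c i * f j i) / f j p * g p + (\<Sum>i\<in>I'. c i * g i)" for g
    proof -
      have "(\<Sum>i\<in>I'. c' i * g i) = (\<Sum>i\<in>I'. c i * g i)"
        using I'(2) by (intro sum.cong) (auto simp: c'_def)
      then show ?thesis using I' by (simp add: c'_def)
    qed
    have "(\<Sum>i\<in>I. c' i * f l i) = 0" if "l \<in> J" for l
    proof -
      have "(\<Sum>i\<in>I'. c i * (f l i - f l p / f j p * f j i)) =
          (\<Sum>i\<in>I'. c i * f l i) - f l p / f j p * (\<Sum>i\<in>I'. c i * f j i)"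
        by (simp add: sum_subtractf sum_distrib_left algebra_simps)
      also have "\<dots> = (\<Sum>i\<in>I. c' i * f l i)" unfolding sum by simp
      finally show ?thesis using c(2)[OF that] by simp
    qed
    moreover have "(\<Sum>i\<in>I. c' i * f j i) = 0" using p unfolding sum by simp
    moreover have "\<exists>i\<in>I. c' i \<noteq> 0" using c(1) I' by (auto simp: c'_def)
    ultimately show ?thesis by blast
  qed
qed

lemma conic_through_divisor:
  assumes ns: "nonsingular_plane_quartic F" and S: "finite S" "S \<subseteq> curve F"
    and deg: "(\<Sum>p\<in>S. n p) < 6"
  obtains A where "conic A" "\<And>p. p \<in> S \<Longrightarrow> n p \<le> intersection_mult F p A"
proof -
  \<comment> \<open>One branch per point is fixed in advance, because the linear conditions must not
    depend on the conic sought.\<close>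
  define a where "a = (\<lambda>p. SOME a. \<exists>v i j k. branch v i j k F p a)"
  have a: "\<exists>v i j k. branch v i j k F p (a p)" if "p \<in> S" for p
  proof -
    have "p \<in> curve F" using S(2) that by blast
    then obtain v i j k b where "branch v i j k F p b" by (rule branch_exists[OF ns])
    then have "\<exists>b v i j k. branch v i j k F p b" by (intro exI)
    then show ?thesis unfolding a_def by (rule someI_ex)
  qed
  define I where "I = {(2::nat,0::nat,0::nat), (0,2,0), (0,0,2), (1,1,0), (1,0,1), (0,1,1)}"
  \<comment> \<open>One condition for each point and each exponent below the prescribed
    multiplicity: that coefficient of the pull-back, linear in the coefficients of the conic, has to
    vanish.\<close>
  define J where "J = Sigma S (\<lambda>p. {..<n p})"
  have I: "finite I" "card I = 6" "\<And>i j k. (i, j, k) \<in> I \<Longrightarrow> i + j + k = 2" by (auto simp: I_def)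
  have "finite J" "card J < card I" using S deg I by (auto simp: J_def card_SigmaI)
  then obtain c where c: "\<exists>x\<in>I. c x \<noteq> 0"
    "\<And>y. y \<in> J \<Longrightarrow> (\<Sum>x\<in>I. c x * (case y of (p, m) \<Rightarrow> case x of (i, j, k) \<Rightarrow>
        fps_nth (ev fps_const (monom3 1 i j k) (a p)) m)) = 0"
    using underdetermined_system[of J I "\<lambda>y x. case y of (p, m) \<Rightarrow> case x of (i, j, k) \<Rightarrow>
        fps_nth (ev fps_const (monom3 1 i j k) (a p)) m"] I by blast
  define A where "A = (\<Sum>x\<in>I. case x of (i, j, k) \<Rightarrow> monom3 (c x) i j k)"
  have A2: "homogeneous 2 A"
    unfolding A_def using I by (intro homogeneous_sum) (auto intro!: homogeneous_monom3)
  have coeff_A: "coeff (coeff (coeff A i) j) k = c (i, j, k)" if "(i, j, k) \<in> I" for i j k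
  proof -
    have "coeff (coeff (coeff A i) j) k = (\<Sum>x\<in>I. if x = (i, j, k) then c x else 0)"
      unfolding A_def coeff_sum by (intro sum.cong) (auto simp: coeff_monom3 split: if_splits)
    then show ?thesis using that I by simp
  qed
  have "A \<noteq> 0" using c(1) coeff_A by force
  then have A: "conic A" using A2 by (simp add: conic_def)
  have nd: "\<not> F dvd A"
    by (rule not_dvd_lower_degree[OF nonsingular_homogeneous[OF ns] A2 \<open>A \<noteq> 0\<close>]) simp
  have "n p \<le> intersection_mult F p A" if p: "p \<in> S" for p
  proof -
    obtain v i j k where "branch v i j k F p (a p)" using a[OF p] by blast
    then interpret branch v i j k F p "a p" .
    have "fps_nth (ev fps_const A (a p)) m = 0" if "m < n p" for m
    proof -
      have "(p, m) \<in> J" using p that by (simp add: J_def)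
      from c(2)[OF this] show ?thesis
        unfolding A_def
        by (simp add: ev_sum ring_map_fps_const fps_sum_nth case_prod_unfold ev_monom3 mult.assoc)
    qed
    moreover have "ev fps_const A (a p) \<noteq> 0" using dvd_of_ev_eq_0 A2 nd by blast
    ultimately show ?thesis by (simp add: intersection_mult_eq[OF A2 nd] subdegree_geI)
  qed
  with A show ?thesis by (rule that)
qed

section \<open>Divisor classes and the inverse in the Jacobian\<close>

lemma divisor_degree_eq_sum:
  assumes "finite S" "{p. D p \<noteq> 0} \<subseteq> S"
  shows "divisor_degree D = (\<Sum>p\<in>S. D p)"
  unfolding divisor_degree_def by (rule sum.mono_neutral_left) (use assms in auto)

lemma divisor_class_eq: "divisor_class F D = {X + D | X. X \<in> principal_divisors F}"
  by (auto simp: divisor_class_def r_coset_def divisor_group_def)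

context
  fixes F
  assumes ns: "nonsingular_plane_quartic F"
begin

lemma divisor_class_eqI:
  assumes "D - E \<in> principal_divisors F"
  shows "divisor_class F D = divisor_class F E"
proof -
  have sub: "divisor_class F D \<subseteq> divisor_class F E" if "D - E \<in> principal_divisors F" for D E
  proof
    fix Y assume "Y \<in> divisor_class F D"
    then obtain X where X: "X \<in> principal_divisors F" "Y = X + D" by (auto simp: divisor_class_eq)
    then have "X + (D - E) \<in> principal_divisors F" "Y = (X + (D - E)) + E"
      using principal_divisors_add[OF ns X(1) that] by simp_all
    then show "Y \<in> divisor_class F E" unfolding divisor_class_eq by blast
  qed
  have "E - D \<in> principal_divisors F" using principal_divisors_uminus[OF assms] by simp
  then show ?thesis using sub assms by blast
qed

lemma divisor_class_0: "divisor_class F 0 = principal_divisors F"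
  by (auto simp: divisor_class_eq)

lemma divisor_class_mult:
  "divisor_class F D \<otimes>\<^bsub>jacobian F\<^esub> divisor_class F E = divisor_class F (D + E)"
proof -
  have "divisor_class F D \<otimes>\<^bsub>jacobian F\<^esub> divisor_class F E =
      {X + Y | X Y. X \<in> divisor_class F D \<and> Y \<in> divisor_class F E}"
    by (auto simp: jacobian_def class_group_def FactGroup_def set_mult_def divisor_group_def)
  also have "\<dots> = divisor_class F (D + E)"
  proof (intro subset_antisym subsetI)
    fix Z assume "Z \<in> {X + Y | X Y. X \<in> divisor_class F D \<and> Y \<in> divisor_class F E}"
    then obtain X Y where "X \<in> principal_divisors F" "Y \<in> principal_divisors F" "Z = (X + D) + (Y + E)"
      by (auto simp: divisor_class_eq)
    then have "X + Y \<in> principal_divisors F" "Z = (X + Y) + (D + E)"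
      using principal_divisors_add[OF ns] by (simp_all add: algebra_simps)
    then show "Z \<in> divisor_class F (D + E)" unfolding divisor_class_eq by blast
  next
    fix Z assume "Z \<in> divisor_class F (D + E)"
    then obtain X where "X \<in> principal_divisors F" "Z = (X + D) + (0 + E)"
      by (auto simp: divisor_class_eq algebra_simps)
    then show "Z \<in> {X + Y | X Y. X \<in> divisor_class F D \<and> Y \<in> divisor_class F E}"
      using principal_divisors_0[OF ns] unfolding divisor_class_eq by blast
  qed
  finally show ?thesis .
qed

lemma jacobian_one: "\<one>\<^bsub>jacobian F\<^esub> = divisor_class F 0"
  by (simp add: jacobian_def class_group_def FactGroup_def divisor_class_0)

text \<open>\<open>m_inv\<close> is a definite description over the carrier. Classes multiply by
  adding representatives, so \<open>- D\<close> gives an inverse, and any other inverse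
  \<open>E\<close> has \<open>E + D\<close> principal, hence the class of
  \<open>- D\<close>.\<close>

lemma inv_jacobian_divisor_class:
  assumes "D \<in> divisors F" "divisor_degree D = 0"
  shows "inv\<^bsub>jacobian F\<^esub> (divisor_class F D) = divisor_class F (- D)"
  unfolding m_inv_def
proof (rule the_equality)
  have "- D \<in> divisors F" "divisor_degree (- D) = 0"
    using assms by (simp_all add: divisors_def divisor_degree_def sum_negf)
  then have "divisor_class F (- D) \<in> carrier (jacobian F)" by (auto simp: jacobian_def)
  then show "divisor_class F (- D) \<in> carrier (jacobian F) \<and>
      divisor_class F D \<otimes>\<^bsub>jacobian F\<^esub> divisor_class F (- D) = \<one>\<^bsub>jacobian F\<^esub> \<and>
      divisor_class F (- D) \<otimes>\<^bsub>jacobian F\<^esub> divisor_class F D = \<one>\<^bsub>jacobian F\<^esub>"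
    by (simp add: divisor_class_mult jacobian_one)
next
  fix y
  assume y: "y \<in> carrier (jacobian F) \<and> divisor_class F D \<otimes>\<^bsub>jacobian F\<^esub> y = \<one>\<^bsub>jacobian F\<^esub> \<and>
      y \<otimes>\<^bsub>jacobian F\<^esub> divisor_class F D = \<one>\<^bsub>jacobian F\<^esub>"
  then obtain E where E: "y = divisor_class F E" by (auto simp: jacobian_def)
  then have "divisor_class F (E + D) = principal_divisors F"
    using y by (simp add: divisor_class_mult jacobian_one divisor_class_0)
  moreover have "E + D \<in> divisor_class F (E + D)"
    using principal_divisors_0[OF ns] by (force simp: divisor_class_eq)
  ultimately have "E - (- D) \<in> principal_divisors F" by simp
  then show "y = divisor_class F (- D)" unfolding E by (rule divisor_class_eqI)
qed

end

theorem mainTheorem5: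
  fixes F :: poly3 and P :: proj_plane and D :: divisor
  assumes "nonsingular_plane_quartic F"
    and "hyperflex F P"
    and "D \<in> divisors F" and "0 \<le> D" and "divisor_degree D = 3"
  shows "(\<exists>A. conic A \<and> D + point_multiple 2 P \<le> cut_divisor F A) \<and>
    (\<forall>A. conic A \<and> D + point_multiple 2 P \<le> cut_divisor F A \<longrightarrow>
       inv\<^bsub>jacobian F\<^esub> (divisor_class F (D - point_multiple 3 P)) =
         divisor_class F (cut_divisor F A - D - point_multiple 5 P))"
proof (intro conjI allI impI)
  note ns = assms(1)
  have P: "P \<in> curve F" using assms(2) by (simp add: hyperflex_def)
  \<comment> \<open>\<open>P\<close> is added because contact 2 is demanded there even when
    \<open>D\<close> does not contain it.\<close>
  define S where "S = {p. D p \<noteq> 0} \<union> {P}"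
  have S: "finite S" "S \<subseteq> curve F" "P \<in> S" "{p. D p \<noteq> 0} \<subseteq> S"
    using assms(3) P by (auto simp: S_def divisors_def)
  have D_nonneg: "0 \<le> D p" for p using assms(4) by (simp add: le_fun_def)
  have sum_D: "(\<Sum>p\<in>S. D p) = 3" using divisor_degree_eq_sum[OF S(1,4)] assms(5) by simp
  have sum_P: "(\<Sum>p\<in>S. point_multiple m P p) = m" for m
    using S by (simp add: point_multiple_def)
  have nonneg: "0 \<le> (D + point_multiple 2 P) p" for p
    using D_nonneg by (simp add: point_multiple_def)
  {
    define n where "n = (\<lambda>p. nat ((D + point_multiple 2 P) p))"
    have "int (\<Sum>p\<in>S. n p) = (\<Sum>p\<in>S. (D + point_multiple 2 P) p)"
      using nonneg by (simp add: n_def)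
    also have "\<dots> = 5" by (simp add: sum.distrib sum_D sum_P)
    finally have "(\<Sum>p\<in>S. n p) < 6" by linarith
    then obtain A where A: "conic A" "\<And>p. p \<in> S \<Longrightarrow> n p \<le> intersection_mult F p A"
      using conic_through_divisor[OF ns S(1,2)] by metis
    have "(D + point_multiple 2 P) p \<le> cut_divisor F A p" for p
    proof (cases "p \<in> S")
      case True
      then have "int (n p) \<le> cut_divisor F A p" using A(2) S(2) by (auto simp: cut_divisor_def)
      then show ?thesis using nonneg[of p] by (simp add: n_def)
    next
      case False
      then have "(D + point_multiple 2 P) p = 0" by (auto simp: S_def point_multiple_def)
      then show ?thesis by (simp add: cut_divisor_def)
    qed
    then show "\<exists>A. conic A \<and> D + point_multiple 2 P \<le> cut_divisor F A"
      using A(1) by (auto simp: le_fun_def)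
  }
  fix A assume "conic A \<and> D + point_multiple 2 P \<le> cut_divisor F A"
  then have A: "homogeneous 2 A" "A \<noteq> 0" by (simp_all add: conic_def)
  define D0 where "D0 = D - point_multiple 3 P"
  have "{p. D0 p \<noteq> 0} \<subseteq> S" by (auto simp: D0_def S_def point_multiple_def)
  then have "D0 \<in> divisors F" "divisor_degree D0 = 0"
    using S divisor_degree_eq_sum[OF S(1), of D0]
    by (auto simp: divisors_def D0_def sum_subtractf sum_D sum_P intro: finite_subset)
  then have "inv\<^bsub>jacobian F\<^esub> (divisor_class F D0) = divisor_class F (- D0)"
    by (rule inv_jacobian_divisor_class[OF ns])
  obtain L where L: "homogeneous 1 L" "L \<noteq> 0" "cut_divisor F L = point_multiple 4 P"
    using hyperflex_tangent[OF ns assms(2)] .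
  have F4: "homogeneous 4 F" by (rule nonsingular_homogeneous[OF ns])
  have "\<not> F dvd L" by (rule not_dvd_lower_degree[OF F4 L(1,2)]) simp
  then have "cut_divisor F (L * L) = point_multiple 8 P"
    using cut_divisor_mult[OF ns L(1) _ L(1)] by (simp add: L(3) point_multiple_def fun_eq_iff)
  moreover have L2: "homogeneous 2 (L * L)" using homogeneous_mult[OF L(1) L(1)] by (simp add: numeral_2_eq_2)
  moreover have "\<not> F dvd A" "\<not> F dvd L * L"
    by (rule not_dvd_lower_degree[OF F4 A], simp) (rule not_dvd_lower_degree[OF F4 L2], use L(2) in simp_all)
  ultimately have "cut_divisor F A - point_multiple 8 P \<in> principal_divisors F"
    using principal_divisorsI[OF A(1) L2] by metis
  \<comment> \<open>Here \<open>8 = 5 + 3\<close>: subtracting \<open>- D0 = 3 P - D\<close> cancels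
    \<open>D\<close> and leaves \<open>8 P\<close>, the divisor of the squared tangent.\<close>
  moreover have "cut_divisor F A - point_multiple 8 P = (cut_divisor F A - D - point_multiple 5 P) - (- D0)"
    by (auto simp: D0_def point_multiple_def fun_eq_iff)
  ultimately have "divisor_class F (cut_divisor F A - D - point_multiple 5 P) = divisor_class F (- D0)"
    using divisor_class_eqI[OF ns] by metis
  then show "inv\<^bsub>jacobian F\<^esub> (divisor_class F (D - point_multiple 3 P)) =
      divisor_class F (cut_divisor F A - D - point_multiple 5 P)"
    using \<open>inv\<^bsub>jacobian F\<^esub> (divisor_class F D0) = _\<close> by (simp add: D0_def)
qed

end
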